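(* Let $e\in\mathbb{Z}_{>1}$, $l,n\in\mathbb{Z}_{>0}$, and let ${\bf s}=(s_1,\ldots,s_l)\in\mathbb{Z}^l$ be such that $s_{i-1}-s_i\ge n-1+e$ for all $i=2,\ldots,l$. Let $\boldsymbol{\lambda}$ be an Uglov $l$-partition of rank $n$ with respect to $(e,{\bf s})$. Write a staggered sequence of residues of $\boldsymbol{\lambda}$ as $$\underbrace{\mathfrak{i}_1,\ldots,\mathfrak{i}_1}_{a_1},\underbrace{\mathfrak{i}_2,\ldots,\mathfrak{i}_2}_{a_2},\ldots,\underbrace{\mathfrak{i}_m,\ldots,\mathfrak{i}_m}_{a_m}$$ with $\mathfrak{i}_j\in\mathbb{Z}/e\mathbb{Z}$, $a_j\in\mathbb{Z}_{>0}$ for all $j\in\{1,\ldots,m\}$ and $\mathfrak{i}_s\ne\mathfrak{i}_{s+1}$ for all $s\in\{1,\ldots,m-1\}$. Then $$f_{\mathfrak{i}_1}^{(a_1)}\cdots f_{\mathfrak{i}_m}^{(a_m)}.\boldsymbol{\emptyset}=\boldsymbol{\lambda}+\sum_{\boldsymbol{\mu}\prec\boldsymbol{\lambda}}c_{\boldsymbol{\lambda},\boldsymbol{\mu}}(v)\,\boldsymbol{\mu}$$ for some Laurent polynomials $c_{\boldsymbol{\lambda},\boldsymbol{\mu}}(v)$ in $v$, where the sum is over $l$-partitions $\boldsymbol{\mu}$ of rank $n$ with $\boldsymbol{\mu}\prec\boldsymbol{\lambda}$.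
   Context: A partition is a finite non-increasing sequence $\lambda=(\lambda_1,\lambda_2,\ldots)$ of non-negative integers; zero parts may be added or deleted freely, and $\ell(\lambda)$ is the number of non-zero parts. An $l$-partition $\boldsymbol{\lambda}=(\lambda^1,\ldots,\lambda^l)$ is an $l$-tuple of partitions; its rank is the sum of all parts; $\Pi^l$ is the set of $l$-partitions; $\boldsymbol{\emptyset}=(\emptyset,\ldots,\emptyset)$. Nodes. $\mathcal{Y}(\boldsymbol{\lambda})=\{(a,b,c): 1\le c\le l,\ 1\le a\le \ell(\lambda^c),\ 1\le b\le\lambda^c_a\}$ is the Young diagram (its elements are nodes). The extended Young diagram $\mathcal{Y}^{\mathrm{ext}}(\boldsymbol{\lambda})$ consists of $\mathcal{Y}(\boldsymbol{\lambda})$ together with the virtual nodes: all $(0,b,c)$ with $b>\lambda^c_1$ and all $(a,0,c)$ with $a>\ell(\lambda^c)$. The vertical (resp. horizontal) boundary is the set of $(a,b,c)\in\mathcal{Y}^{\mathrm{ext}}(\boldsymbol{\lambda})$ with $(a,b+1,c)\notin\mathcal{Y}^{\mathrm{ext}}(\boldsymbol{\lambda})$ (resp. $(a+1,b,c)\notin\mathcal{Y}^{\mathrm{ext}}(\boldsymbol{\lambda})$); the boundary is their union. A node $\gamma$ of $\boldsymbol{\lambda}$ is removable if $\mathcal{Y}(\boldsymbol{\lambda})\setminus\{\gamma\}$ is the Young diagram of an $l$-partition; $\gamma\in\mathbb{Z}_{>0}\times\mathbb{Z}_{>0}\times\{1,\ldots,l\}$, $\gamma\notin\mathcal{Y}(\boldsymbol{\lambda})$,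 is addable if $\mathcal{Y}(\boldsymbol{\lambda})\sqcup\{\gamma\}$ is the Young diagram of an $l$-partition. For $\gamma=(a,b,c)$, $\mathrm{cont}(\gamma)=b-a+s_c$; the residue is $\mathrm{cont}(\gamma)$ modulo $e$; $\gamma$ is a $\mathfrak{j}$-node if its residue is $\mathfrak{j}$. For nodes $\gamma_1,\gamma_2$ (extended or addable) of the same residue in components $c_1,c_2$: $\gamma_1<\gamma_2$ iff $\mathrm{cont}(\gamma_1)<\mathrm{cont}(\gamma_2)$, or $\mathrm{cont}(\gamma_1)=\mathrm{cont}(\gamma_2)$ and $c_1>c_2$. Write $\gamma_1<_{co}\gamma_2$ if either $\mathrm{cont}(\gamma_1)=\mathrm{cont}(\gamma_2)$ and $c_1=c_2+1$, or $\mathrm{cont}(\gamma_1)+e=\mathrm{cont}(\gamma_2)$, $c_1=1$, $c_2=l$. Staggered. A staggered sequence of $\mathfrak{j}$-nodes of $\boldsymbol{\lambda}$ is an infinite sequence $(\gamma_i)_{i\in\mathbb{Z}_{>0}}$ of extended $\mathfrak{j}$-nodes of the boundary such that: $\gamma_i<_{co}\gamma_{i+1}$ for all $i$; some $\gamma_s$ is removable; and either all extended $\mathfrak{j}$-nodes $\gamma<\gamma_1$ of the boundary are virtual nodes of the vertical boundary, or there is an addable $\mathfrak{j}$-node $\gamma$ with $\gamma<_{co}\gamma_1$. $\boldsymbol{\lambda}$ is a staggered $l$-partition if $\boldsymbol{\lambda}=\boldsymbol{\emptyset}$, or if for some $\mathfrak{j}$ it admits a staggered sequence of $\mathfrak{j}$-nodes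 such that deleting all removable nodes of the sequence gives a staggered $l$-partition $\boldsymbol{\lambda}'$. In that case, if $r$ removable nodes are deleted, a staggered sequence of residues of $\boldsymbol{\lambda}$ is the concatenation of $(\mathfrak{j},\ldots,\mathfrak{j})$ ($r$ times) with a staggered sequence of residues of $\boldsymbol{\lambda}'$ (the empty sequence for $\boldsymbol{\emptyset}$). Uglov. Write the addable and removable $\mathfrak{j}$-nodes of $\boldsymbol{\lambda}$ in increasing order as a word in $A$ (addable) and $R$ (removable), and delete factors $RA$ recursively until none remains, obtaining $A^pR^q$; if $q>0$ the node of the leftmost remaining $R$ is the good removable $\mathfrak{j}$-node. Recursively, $\boldsymbol{\emptyset}$ is Uglov, and a non-empty $\boldsymbol{\lambda}$ is Uglov iff for some $\mathfrak{j}$ it has a good removable $\mathfrak{j}$-node whose removal gives an Uglov $l$-partition. The Uglov $l$-partitions are exactly the staggered $l$-partitions (both with respect to $(e,{\bf s})$). Quantized action. Let $v$ be an indeterminate. On the $\mathbb{Q}(v)$-vector space with basis $\Pi^l$, $f_{\mathfrak{i}}$ acts by $f_{\mathfrak{i}}\boldsymbol{\lambda}=\sum_{\boldsymbol{\mu}}v^{N(\boldsymbol{\lambda},\boldsymbol{\mu})}\boldsymbol{\mu}$, over all $\boldsymbol{\mu}$ with $\mathcal{Y}(\boldsymbol{\mu})=\mathcal{Y}(\boldsymbol{\lambda})\sqcup\{\gamma\}$, $\gamma$ an $\mathfrak{i}$-node, where $N(\boldsymbol{\lambda},\boldsymbol{\mu})$ is the number of addable $\mathfrak{i}$-nodes $\gamma'>\gamma$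 of $\boldsymbol{\lambda}$ minus the number of removable $\mathfrak{i}$-nodes $\gamma'>\gamma$ of $\boldsymbol{\mu}$. The divided power is $f_{\mathfrak{i}}^{(k)}=f_{\mathfrak{i}}^k/[k]_v!$, with $[m]_v=(v^m-v^{-m})/(v-v^{-1})$ and $[k]_v!=[1]_v\cdots[k]_v$. Lexicographic order. For $l$-partitions of the same rank, $\boldsymbol{\lambda}\prec\boldsymbol{\mu}$ if there are $j\in\{1,\ldots,l\}$, $k\in\mathbb{Z}_{>0}$ with $\lambda^t=\mu^t$ for $t<j$, $\lambda^j_m=\mu^j_m$ for $m<k$ and $\lambda^j_k<\mu^j_k$. *)

theory Defs
  imports
    "HOL-Library.Poly_Mapping"
    "HOL-Computational_Algebra.Polynomial_Factorial"
begin

section \<open>Multipartitions and nodes\<close>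

text \<open>
  Rows and components are numbered from 1.  Partitions are padded with zeros (also at the
  junk index 0, and at components outside 1..l), so that two partitions which differ only in
  zero parts are equal.
\<close>

type_synonym partition = "nat \<Rightarrow> nat"
type_synonym mpart = "nat \<Rightarrow> partition"
type_synonym node = "nat \<times> nat \<times> nat"

definition is_partition :: "partition \<Rightarrow> bool" where
  "is_partition p \<longleftrightarrow> p 0 = 0 \<and> (\<forall>a\<ge>1. p (Suc a) \<le> p a) \<and> finite {a. p a \<noteq> 0}"

definition len :: "partition \<Rightarrow> nat" where
  "len p = card {a. p a \<noteq> 0}"

definition lpart :: "nat \<Rightarrow> mpart \<Rightarrow> bool" where
  "lpart l L \<longleftrightarrow> (\<forall>c\<in>{1..l}. is_partition (L c)) \<and> (\<forall>c. c \<notin> {1..l} \<longrightarrow> L c = (\<lambda>_. 0))"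

definition rank :: "nat \<Rightarrow> mpart \<Rightarrow> nat" where
  "rank l L = (\<Sum>c=1..l. \<Sum>a=1..len (L c). L c a)"

definition empty_mpart :: mpart where
  "empty_mpart = (\<lambda>_ _. 0)"

definition young :: "nat \<Rightarrow> mpart \<Rightarrow> node set" where
  "young l L = {(a, b, c). 1 \<le> c \<and> c \<le> l \<and> 1 \<le> a \<and> a \<le> len (L c) \<and> 1 \<le> b \<and> b \<le> L c a}"

definition virtual :: "nat \<Rightarrow> mpart \<Rightarrow> node set" where
  "virtual l L = {(0, b, c) | b c. c \<in> {1..l} \<and> b > L c 1} \<union>
                 {(a, 0, c) | a c. c \<in> {1..l} \<and> a > len (L c)}"

definition young_ext :: "nat \<Rightarrow> mpart \<Rightarrow> node set" where
  "young_ext l L = young l L \<union> virtual l L"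

definition vboundary :: "nat \<Rightarrow> mpart \<Rightarrow> node set" where
  "vboundary l L = {(a, b, c). (a, b, c) \<in> young_ext l L \<and> (a, Suc b, c) \<notin> young_ext l L}"

definition hboundary :: "nat \<Rightarrow> mpart \<Rightarrow> node set" where
  "hboundary l L = {(a, b, c). (a, b, c) \<in> young_ext l L \<and> (Suc a, b, c) \<notin> young_ext l L}"

definition boundary :: "nat \<Rightarrow> mpart \<Rightarrow> node set" where
  "boundary l L = vboundary l L \<union> hboundary l L"

definition removable :: "nat \<Rightarrow> mpart \<Rightarrow> node \<Rightarrow> bool" where
  "removable l L \<gamma> \<longleftrightarrow>
     \<gamma> \<in> young l L \<and> (\<exists>M. lpart l M \<and> young l M = young l L - {\<gamma>})"

definition addable :: "nat \<Rightarrow> mpart \<Rightarrow> node \<Rightarrow> bool" where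
  "addable l L \<gamma> \<longleftrightarrow>
     \<gamma> \<in> {1..} \<times> {1..} \<times> {1..l} \<and> \<gamma> \<notin> young l L \<and>
     (\<exists>M. lpart l M \<and> young l M = insert \<gamma> (young l L))"

text \<open>Residues in \<open>\<int>/e\<int>\<close> are represented by the integers in \<open>{0..<e}\<close>.\<close>

fun cont :: "(nat \<Rightarrow> int) \<Rightarrow> node \<Rightarrow> int" where
  "cont s (a, b, c) = int b - int a + s c"

definition residue :: "int \<Rightarrow> (nat \<Rightarrow> int) \<Rightarrow> node \<Rightarrow> int" where
  "residue e s \<gamma> = cont s \<gamma> mod e"

abbreviation component :: "node \<Rightarrow> nat" where
  "component \<gamma> \<equiv> snd (snd \<gamma>)"

definition node_less :: "(nat \<Rightarrow> int) \<Rightarrow> node \<Rightarrow> node \<Rightarrow> bool" where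
  "node_less s \<gamma>1 \<gamma>2 \<longleftrightarrow>
     cont s \<gamma>1 < cont s \<gamma>2 \<or> cont s \<gamma>1 = cont s \<gamma>2 \<and> component \<gamma>1 > component \<gamma>2"

definition co_less :: "int \<Rightarrow> nat \<Rightarrow> (nat \<Rightarrow> int) \<Rightarrow> node \<Rightarrow> node \<Rightarrow> bool" where
  "co_less e l s \<gamma>1 \<gamma>2 \<longleftrightarrow>
     cont s \<gamma>1 = cont s \<gamma>2 \<and> component \<gamma>1 = component \<gamma>2 + 1 \<or>
     cont s \<gamma>1 + e = cont s \<gamma>2 \<and> component \<gamma>1 = 1 \<and> component \<gamma>2 = l"


section \<open>Staggered sequences\<close>

text \<open>The sequence is indexed from 0, so \<open>\<gamma> 0\<close> is its first term.\<close>

definition staggered_seq ::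
  "int \<Rightarrow> nat \<Rightarrow> (nat \<Rightarrow> int) \<Rightarrow> int \<Rightarrow> mpart \<Rightarrow> (nat \<Rightarrow> node) \<Rightarrow> bool" where
  "staggered_seq e l s j L \<gamma> \<longleftrightarrow>
     (\<forall>i. \<gamma> i \<in> boundary l L \<and> residue e s (\<gamma> i) = j) \<and>
     (\<forall>i. co_less e l s (\<gamma> i) (\<gamma> (Suc i))) \<and>
     (\<exists>i. removable l L (\<gamma> i)) \<and>
     ((\<forall>\<delta>\<in>boundary l L. residue e s \<delta> = j \<and> node_less s \<delta> (\<gamma> 0)
          \<longrightarrow> \<delta> \<in> virtual l L \<inter> vboundary l L) \<or>
      (\<exists>\<delta>. addable l L \<delta> \<and> residue e s \<delta> = j \<and> co_less e l s \<delta> (\<gamma> 0)))"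

definition removed_nodes :: "nat \<Rightarrow> mpart \<Rightarrow> (nat \<Rightarrow> node) \<Rightarrow> node set" where
  "removed_nodes l L \<gamma> = {\<delta> \<in> range \<gamma>. removable l L \<delta>}"

inductive staggered :: "int \<Rightarrow> nat \<Rightarrow> (nat \<Rightarrow> int) \<Rightarrow> mpart \<Rightarrow> bool" for e l s where
  empty: "staggered e l s empty_mpart"
| step: "staggered e l s L"
    if "lpart l L" "staggered_seq e l s j L \<gamma>"
       "lpart l M" "young l M = young l L - removed_nodes l L \<gamma>" "staggered e l s M"

inductive staggered_residues ::
  "int \<Rightarrow> nat \<Rightarrow> (nat \<Rightarrow> int) \<Rightarrow> mpart \<Rightarrow> int list \<Rightarrow> bool" for e l s where
  empty: "staggered_residues e l s empty_mpart []"
| step: "staggered_residues e l s L (replicate (card (removed_nodes l L \<gamma>)) j @ rs)"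
    if "lpart l L" "staggered_seq e l s j L \<gamma>"
       "lpart l M" "young l M = young l L - removed_nodes l L \<gamma>" "staggered_residues e l s M rs"

lemma staggered_iff_residues: "staggered e l s L \<longleftrightarrow> (\<exists>rs. staggered_residues e l s L rs)"
proof
  assume "staggered e l s L"
  then show "\<exists>rs. staggered_residues e l s L rs"
    by induction (blast intro: staggered_residues.intros)+
next
  assume "\<exists>rs. staggered_residues e l s L rs"
  then obtain rs where "staggered_residues e l s L rs" ..
  then show "staggered e l s L"
    by induction (blast intro: staggered.intros)+
qed


section \<open>Uglov multipartitions\<close>

text \<open>
  Words in \<open>A\<close>, \<open>R\<close> are kept as lists of the nodes themselves; whether a letter is \<open>A\<close> or \<open>R\<close>
  is read off from the node.  The \<open>j\<close>-nodes that are addable or removable are totally ordered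
  by \<^const>\<open>node_less\<close>, so the word is unique.
\<close>

definition node_word :: "int \<Rightarrow> nat \<Rightarrow> (nat \<Rightarrow> int) \<Rightarrow> int \<Rightarrow> mpart \<Rightarrow> node list \<Rightarrow> bool" where
  "node_word e l s j L w \<longleftrightarrow>
     sorted_wrt (node_less s) w \<and>
     set w = {\<gamma>. (addable l L \<gamma> \<or> removable l L \<gamma>) \<and> residue e s \<gamma> = j}"

inductive delete_RA :: "nat \<Rightarrow> mpart \<Rightarrow> node list \<Rightarrow> node list \<Rightarrow> bool" for l L where
  "removable l L \<gamma> \<Longrightarrow> addable l L \<delta> \<Longrightarrow> delete_RA l L (xs @ [\<gamma>, \<delta>] @ ys) (xs @ ys)"

definition good_removable :: "int \<Rightarrow> nat \<Rightarrow> (nat \<Rightarrow> int) \<Rightarrow> int \<Rightarrow> mpart \<Rightarrow> node \<Rightarrow> bool" where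
  "good_removable e l s j L \<gamma> \<longleftrightarrow>
     (\<exists>w w' xs ys. node_word e l s j L w \<and>
        (delete_RA l L)\<^sup>*\<^sup>* w w' \<and> (\<nexists>w''. delete_RA l L w' w'') \<and>
        w' = xs @ \<gamma> # ys \<and> removable l L \<gamma> \<and> (\<forall>\<delta>\<in>set xs. \<not> removable l L \<delta>))"

inductive uglov :: "int \<Rightarrow> nat \<Rightarrow> (nat \<Rightarrow> int) \<Rightarrow> mpart \<Rightarrow> bool" for e l s where
  empty: "uglov e l s empty_mpart"
| step: "uglov e l s L"
    if "lpart l L" "good_removable e l s j L \<gamma>"
       "lpart l M" "young l M = young l L - {\<gamma>}" "uglov e l s M"


section \<open>The quantized action on the Fock space\<close>

text \<open>The field \<open>\<rat>(v)\<close> is the fraction field of the polynomial ring over the rationals.\<close>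

type_synonym ratfun = "rat poly fract"

definition qv :: ratfun where
  "qv = to_fract [:0, 1:]"

definition laurent :: "ratfun \<Rightarrow> bool" where
  "laurent x \<longleftrightarrow> (\<exists>p k. x = to_fract p / qv ^ k)"

definition qint :: "nat \<Rightarrow> ratfun" where
  "qint m = (qv powi int m - qv powi (- int m)) / (qv - qv powi (-1))"

definition qfact :: "nat \<Rightarrow> ratfun" where
  "qfact k = (\<Prod>m=1..k. qint m)"

text \<open>
  Formal linear combinations of all multipartitions; the ones whose keys are \<open>l\<close>-partitions form
  the Fock space, which the operators below preserve.
\<close>

type_synonym fock = "mpart \<Rightarrow>\<^sub>0 ratfun"

definition fock_scale :: "ratfun \<Rightarrow> fock \<Rightarrow> fock" where
  "fock_scale x u = Poly_Mapping.map (\<lambda>y. x * y) u"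

definition adds_node :: "int \<Rightarrow> nat \<Rightarrow> (nat \<Rightarrow> int) \<Rightarrow> int \<Rightarrow> mpart \<Rightarrow> mpart \<Rightarrow> node \<Rightarrow> bool" where
  "adds_node e l s i L M \<gamma> \<longleftrightarrow>
     lpart l M \<and> \<gamma> \<notin> young l L \<and> young l M = insert \<gamma> (young l L) \<and> residue e s \<gamma> = i"

definition N_exp :: "int \<Rightarrow> nat \<Rightarrow> (nat \<Rightarrow> int) \<Rightarrow> int \<Rightarrow> mpart \<Rightarrow> mpart \<Rightarrow> int" where
  "N_exp e l s i L M =
     (let \<gamma> = (THE \<gamma>. adds_node e l s i L M \<gamma>) in
        int (card {\<delta>. addable l L \<delta> \<and> residue e s \<delta> = i \<and> node_less s \<gamma> \<delta>}) -
        int (card {\<delta>. removable l M \<delta> \<and> residue e s \<delta> = i \<and> node_less s \<gamma> \<delta>}))"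

definition f_basis :: "int \<Rightarrow> nat \<Rightarrow> (nat \<Rightarrow> int) \<Rightarrow> int \<Rightarrow> mpart \<Rightarrow> fock" where
  "f_basis e l s i L =
     (\<Sum>M | \<exists>\<gamma>. adds_node e l s i L M \<gamma>. Poly_Mapping.single M (qv powi N_exp e l s i L M))"

definition f_op :: "int \<Rightarrow> nat \<Rightarrow> (nat \<Rightarrow> int) \<Rightarrow> int \<Rightarrow> fock \<Rightarrow> fock" where
  "f_op e l s i u =
     (\<Sum>L\<in>Poly_Mapping.keys u. fock_scale (Poly_Mapping.lookup u L) (f_basis e l s i L))"

definition f_divpow :: "int \<Rightarrow> nat \<Rightarrow> (nat \<Rightarrow> int) \<Rightarrow> int \<Rightarrow> nat \<Rightarrow> fock \<Rightarrow> fock" where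
  "f_divpow e l s i k u = fock_scale (1 / qfact k) ((f_op e l s i ^^ k) u)"


section \<open>Lexicographic order\<close>

definition lex_less :: "nat \<Rightarrow> mpart \<Rightarrow> mpart \<Rightarrow> bool" where
  "lex_less l L M \<longleftrightarrow>
     (\<exists>j\<in>{1..l}. \<exists>k\<ge>1. (\<forall>t\<in>{1..<j}. L t = M t) \<and>
        (\<forall>m\<in>{1..<k}. L j m = M j m) \<and> L j k < M j k)"

end

(*
  On the nodes of a fixed residue j, the relation <_co is the successor relation of the total
  order <, and a diagonal carries an addable node or a node of the boundary but not both. So a
  staggered sequence meets every diagonal from its first one on and no addable j-node lies there:
  a staggered step removes from L the removable j-nodes above some bound, leading to an M of which
  the removed nodes are the r largest addable j-nodes, above all its removable ones. In
  particular the next step has a different residue, so that the steps are the blocks of equal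
  residues in the sequence.

  The coefficients of f_j^(r) M are powers of v, and the one of L is 1. Because of the gaps in the
  charge, larger addable nodes sit in lexicographically earlier rows, so L is the greedy choice;
  a row-by-row comparison shows that adding r j-nodes to M or to any N below M otherwise gives
  something below L.
*)

theory Submission
  imports Defs
begin

section \<open>Young diagrams of multipartitions\<close>

text \<open>Since \<open>e > 1\<close>, horizontally or vertically adjacent nodes have different
  residues, so j-nodes are added independently of one another: a term of f_j^(r) applied to a basis
  vector is a choice of r addable j-nodes, and adding one merely turns it from addable into
  removable. The orders in which a fixed choice can be added differ in weight by v^(-2) per
  inversion; together they give one power of v times [r]_v!, which the divided power cancels. The
  obstacle lies in the terms N below M. Their addable j-nodes may be quite different from those of
  M, so the choices in N and in M are not directly comparable. Only the rows before the first
  difference of N and M are shared; there the choices are compared through the order on the nodes of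
  M alone. The remaining case, in which N catches up in the first differing row, is decided by
  residues one row further.\<close>

definition diagram :: "nat \<Rightarrow> node set \<Rightarrow> bool" where
  "diagram l Y \<longleftrightarrow> finite Y \<and> Y \<subseteq> {1..} \<times> {1..} \<times> {1..l} \<and>
     (\<forall>a b c a' b'. (a, b, c) \<in> Y \<and> 1 \<le> a' \<and> a' \<le> a \<and> 1 \<le> b' \<and> b' \<le> b \<longrightarrow> (a', b', c) \<in> Y)"

lemma diagram_closed:
  assumes "diagram l Y" "(a, b, c) \<in> Y" "1 \<le> a'" "a' \<le> a" "1 \<le> b'" "b' \<le> b"
  shows "(a', b', c) \<in> Y"
  using assms unfolding diagram_def by blast

definition shape :: "node set \<Rightarrow> mpart" where
  "shape Y c a = card {b. (a, b, c) \<in> Y}"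

lemma partition_antimono:
  assumes "is_partition p" "1 \<le> a" "a \<le> a'"
  shows "p a' \<le> p a"
  using assms(3,2)
proof (induction rule: dec_induct)
  case (step n)
  then show ?case using assms(1) unfolding is_partition_def by (meson le_trans)
qed simp

lemma down_closed_nat_set:
  fixes B :: "nat set"
  assumes "finite B" "0 \<notin> B" "\<And>b b'. b \<in> B \<Longrightarrow> 1 \<le> b' \<Longrightarrow> b' \<le> b \<Longrightarrow> b' \<in> B"
  shows "B = {1..card B}"
proof (cases "B = {}")
  case False
  have "B = {1..Max B}"
  proof
    show "B \<subseteq> {1..Max B}"
      using assms(1,2) by (metis Max_ge One_nat_def Suc_leI atLeastAtMost_iff gr0I subsetI)
    show "{1..Max B} \<subseteq> B"
      using assms False by (meson Max_in atLeastAtMost_iff subsetI)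
  qed
  then show ?thesis by (metis card_atLeastAtMost diff_Suc_1)
qed simp

lemma partition_support:
  assumes "is_partition p"
  shows "{a. p a \<noteq> 0} = {1..len p}"
  unfolding len_def
proof (rule down_closed_nat_set)
  show "finite {a. p a \<noteq> 0}" "0 \<notin> {a. p a \<noteq> 0}"
    using assms by (auto simp: is_partition_def)
  show "b' \<in> {a. p a \<noteq> 0}" if "b \<in> {a. p a \<noteq> 0}" "1 \<le> b'" "b' \<le> b" for b b'
    using that partition_antimono[OF assms that(2,3)] by auto
qed

lemma le_len_iff:
  assumes "is_partition p" "1 \<le> a"
  shows "a \<le> len p \<longleftrightarrow> p a > 0"
  using partition_support[OF assms(1)] assms(2) by (auto simp: set_eq_iff)

lemma mem_young:
  assumes "lpart l L"
  shows "(a, b, c) \<in> young l L \<longleftrightarrow> c \<in> {1..l} \<and> 1 \<le> a \<and> 1 \<le> b \<and> b \<le> L c a"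
  using assms le_len_iff[of "L c" a] unfolding young_def lpart_def by auto

lemma lpart_antimono:
  assumes "lpart l L" "1 \<le> a" "a \<le> a'"
  shows "L c a' \<le> L c a"
  using assms partition_antimono[of "L c" a a'] unfolding lpart_def by (cases "c \<in> {1..l}") auto

lemma lpart_row_0: "lpart l L \<Longrightarrow> L c 0 = 0"
  unfolding lpart_def is_partition_def by (cases "c \<in> {1..l}") auto

lemma lpart_zero_component: "lpart l L \<Longrightarrow> c \<notin> {1..l} \<Longrightarrow> L c a = 0"
  unfolding lpart_def by simp

lemma finite_young: "finite (young l L)"
proof -
  have "young l L \<subseteq> (\<Union>c\<in>{1..l}. \<Union>a\<in>{1..len (L c)}. \<Union>b\<in>{1..L c a}. {(a, b, c)})"
    unfolding young_def by auto
  then show ?thesis by (rule finite_subset) auto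
qed

lemma diagram_young:
  assumes "lpart l L"
  shows "diagram l (young l L)"
  unfolding diagram_def
proof (intro conjI allI impI)
  show "finite (young l L)" by (rule finite_young)
  show "young l L \<subseteq> {1..} \<times> {1..} \<times> {1..l}" unfolding young_def by auto
  fix a b c a' b'
  assume "(a, b, c) \<in> young l L \<and> 1 \<le> a' \<and> a' \<le> a \<and> 1 \<le> b' \<and> b' \<le> b"
  then show "(a', b', c) \<in> young l L"
    using lpart_antimono[OF assms, of a' a c] by (auto simp: mem_young[OF assms])
qed

lemma shape_young:
  assumes "lpart l L"
  shows "shape (young l L) = L"
proof (intro ext)
  fix c a
  have "L c a = 0" if "\<not> (c \<in> {1..l} \<and> 1 \<le> a)"
    using that lpart_row_0[OF assms] lpart_zero_component[OF assms] by (cases a) auto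
  moreover have "{b. (a, b, c) \<in> young l L} = (if c \<in> {1..l} \<and> 1 \<le> a then {1..L c a} else {})"
    by (auto simp: mem_young[OF assms])
  ultimately show "shape (young l L) c a = L c a" unfolding shape_def by auto
qed

lemma young_inj: "lpart l L \<Longrightarrow> lpart l M \<Longrightarrow> young l L = young l M \<Longrightarrow> L = M"
  by (metis shape_young)

lemma diagram_row:
  assumes "diagram l Y"
  shows "(a, b, c) \<in> Y \<longleftrightarrow> 1 \<le> b \<and> b \<le> shape Y c a"
proof -
  have "{b. (a, b, c) \<in> Y} = {1..card {b. (a, b, c) \<in> Y}}"
  proof (rule down_closed_nat_set)
    have "{b. (a, b, c) \<in> Y} \<subseteq> (fst \<circ> snd) ` Y" by force
    then show "finite {b. (a, b, c) \<in> Y}"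
      using assms unfolding diagram_def by (meson finite_imageI finite_subset)
    show "0 \<notin> {b. (a, b, c) \<in> Y}" using assms unfolding diagram_def by auto
    show "b' \<in> {b. (a, b, c) \<in> Y}" if "b \<in> {b. (a, b, c) \<in> Y}" "1 \<le> b'" "b' \<le> b" for b b'
      using that assms unfolding diagram_def by fastforce
  qed
  then show ?thesis unfolding shape_def by (metis atLeastAtMost_iff mem_Collect_eq)
qed

lemma lpart_shape:
  assumes "diagram l Y"
  shows "lpart l (shape Y)"
  unfolding lpart_def
proof (intro conjI ballI allI impI)
  fix c assume "c \<in> {1..l}"
  show "is_partition (shape Y c)"
    unfolding is_partition_def
  proof (intro conjI allI impI)
    have "(0, b, c) \<notin> Y" for b using assms unfolding diagram_def by auto
    then show "shape Y c 0 = 0" unfolding shape_def by simp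
    show "shape Y c (Suc a) \<le> shape Y c a" if "1 \<le> a" for a
    proof (cases "shape Y c (Suc a) = 0")
      case False
      then have "(Suc a, shape Y c (Suc a), c) \<in> Y" by (simp add: diagram_row[OF assms])
      moreover have "1 \<le> shape Y c (Suc a)" "a \<le> Suc a" using False by auto
      ultimately have "(a, shape Y c (Suc a), c) \<in> Y"
        using assms that unfolding diagram_def by blast
      then show ?thesis by (simp add: diagram_row[OF assms])
    qed simp
    have "{a. shape Y c a \<noteq> 0} \<subseteq> fst ` Y"
    proof
      fix a assume "a \<in> {a. shape Y c a \<noteq> 0}"
      then have "(a, shape Y c a, c) \<in> Y" by (simp add: diagram_row[OF assms])
      then show "a \<in> fst ` Y" by force
    qed
    then show "finite {a. shape Y c a \<noteq> 0}"
      using assms unfolding diagram_def by (meson finite_imageI finite_subset)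
  qed
next
  fix c assume "c \<notin> {1..l}"
  then have "(a, b, c) \<notin> Y" for a b using assms unfolding diagram_def by blast
  then show "shape Y c = (\<lambda>_. 0)" unfolding shape_def by auto
qed

lemma young_shape:
  assumes "diagram l Y"
  shows "young l (shape Y) = Y"
proof -
  have "(a, b, c) \<in> Y \<Longrightarrow> 1 \<le> a \<and> c \<in> {1..l}" for a b c
    using assms unfolding diagram_def by auto
  then have "(a, b, c) \<in> young l (shape Y) \<longleftrightarrow> (a, b, c) \<in> Y" for a b c
    unfolding mem_young[OF lpart_shape[OF assms]] using diagram_row[OF assms] by blast
  then show ?thesis by auto
qed

text \<open>Trades the existential quantifiers over multipartitions in \<open>addable\<close> and
  \<open>removable\<close> for closure conditions on sets of nodes.\<close>

lemma diagram_iff: "diagram l Y \<longleftrightarrow> (\<exists>M. lpart l M \<and> young l M = Y)"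
  using diagram_young lpart_shape young_shape by metis

section \<open>Local criteria for addable and removable nodes\<close>

lemma addable_iff:
  assumes "lpart l L"
  shows "addable l L (a, b, c) \<longleftrightarrow> 1 \<le> a \<and> 1 \<le> b \<and> c \<in> {1..l} \<and> (a, b, c) \<notin> young l L \<and>
    (1 < a \<longrightarrow> (a - 1, b, c) \<in> young l L) \<and> (1 < b \<longrightarrow> (a, b - 1, c) \<in> young l L)"
    (is "_ \<longleftrightarrow> ?R")
proof
  assume "addable l L (a, b, c)"
  then have n: "1 \<le> a" "1 \<le> b" "c \<in> {1..l}" "(a, b, c) \<notin> young l L"
    and d: "diagram l (insert (a, b, c) (young l L))"
    unfolding addable_def diagram_iff by auto
  have "(a - 1, b, c) \<in> young l L" if "1 < a"
    using that n diagram_closed[OF d, of a b c "a - 1" b]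
    by (auto simp: Suc_le_eq)
  moreover have "(a, b - 1, c) \<in> young l L" if "1 < b"
    using that n diagram_closed[OF d, of a b c a "b - 1"]
    by (auto simp: Suc_le_eq)
  ultimately show ?R using n by blast
next
  assume R: ?R
  have "(a', b', c) \<in> insert (a, b, c) (young l L)"
    if "1 \<le> a'" "a' \<le> a" "1 \<le> b'" "b' \<le> b" for a' b'
  proof (cases "a' = a")
    case True
    show ?thesis
    proof (cases "b' = b")
      case False
      then have "1 < b" "b' \<le> b - 1" using that by auto
      then show ?thesis
        using R True that diagram_young[OF assms] unfolding diagram_def by blast
    qed (use True in simp)
  next
    case False
    then have "1 < a" "a' \<le> a - 1" using that by auto
    then show ?thesis
      using R that diagram_young[OF assms] unfolding diagram_def by blast
  qed
  then have "(x', y', z) \<in> insert (a, b, c) (young l L)"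
    if "(x, y, z) \<in> insert (a, b, c) (young l L)" "1 \<le> x'" "x' \<le> x" "1 \<le> y'" "y' \<le> y"
    for x y z x' y'
    using that diagram_closed[OF diagram_young[OF assms], of x y z x' y'] by blast
  moreover have "insert (a, b, c) (young l L) \<subseteq> {1..} \<times> {1..} \<times> {1..l}"
    using R diagram_young[OF assms] unfolding diagram_def by simp
  ultimately have "diagram l (insert (a, b, c) (young l L))"
    unfolding diagram_def using finite_young by blast
  then show "addable l L (a, b, c)" using R unfolding addable_def diagram_iff by auto
qed

lemma removable_iff:
  assumes "lpart l L"
  shows "removable l L (a, b, c) \<longleftrightarrow>
    (a, b, c) \<in> young l L \<and> (Suc a, b, c) \<notin> young l L \<and> (a, Suc b, c) \<notin> young l L"
    (is "_ \<longleftrightarrow> ?R")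
proof
  assume "removable l L (a, b, c)"
  then have y: "(a, b, c) \<in> young l L" and d: "diagram l (young l L - {(a, b, c)})"
    unfolding removable_def diagram_iff by auto
  have "1 \<le> a" "1 \<le> b" using y by (auto simp: mem_young[OF assms])
  have "(a', b', c) \<notin> young l L - {(a, b, c)}" if "a \<le> a'" "b \<le> b'" for a' b'
    using d that \<open>1 \<le> a\<close> \<open>1 \<le> b\<close> unfolding diagram_def by blast
  from this[of "Suc a" b] this[of a "Suc b"] show ?R using y by auto
next
  assume R: ?R
  have *: "(a', b', c) \<notin> young l L" if "a \<le> a'" "b \<le> b'" "(a', b') \<noteq> (a, b)" for a' b'
  proof
    assume y: "(a', b', c) \<in> young l L"
    have "1 \<le> a" "1 \<le> b" using R by (auto simp: mem_young[OF assms])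
    moreover have "Suc a \<le> a' \<or> Suc b \<le> b'" using that by auto
    ultimately have "(Suc a, b, c) \<in> young l L \<or> (a, Suc b, c) \<in> young l L"
      using that y by (auto intro: diagram_closed[OF diagram_young[OF assms]])
    then show False using R by blast
  qed
  have "diagram l (young l L - {(a, b, c)})"
    unfolding diagram_def
  proof (intro conjI allI impI)
    show "finite (young l L - {(a, b, c)})" using finite_young by simp
    show "young l L - {(a, b, c)} \<subseteq> {1..} \<times> {1..} \<times> {1..l}"
      using diagram_young[OF assms] unfolding diagram_def by blast
    fix x y z x' y'
    assume h: "(x, y, z) \<in> young l L - {(a, b, c)} \<and> 1 \<le> x' \<and> x' \<le> x \<and> 1 \<le> y' \<and> y' \<le> y"
    then have "(x', y', z) \<in> young l L"
      using diagram_young[OF assms] unfolding diagram_def by blast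
    then show "(x', y', z) \<in> young l L - {(a, b, c)}" using * h by blast
  qed
  then show "removable l L (a, b, c)" using R unfolding removable_def diagram_iff by auto
qed

lemma addable_row:
  assumes "lpart l L" "addable l L (a, b, c)"
  shows "b = Suc (L c a)"
  using assms(2) unfolding addable_iff[OF assms(1)] mem_young[OF assms(1)] by auto

lemma removable_row:
  assumes "lpart l L" "removable l L (a, b, c)"
  shows "b = L c a" "L c (Suc a) < b"
  using assms(2) unfolding removable_iff[OF assms(1)] mem_young[OF assms(1)] by auto

lemma component_addable: "addable l L \<gamma> \<Longrightarrow> component \<gamma> \<in> {1..l}"
  unfolding addable_def by (cases \<gamma>) auto

lemma finite_addable:
  assumes "lpart l L"
  shows "finite {\<gamma>. addable l L \<gamma>}"
proof -
  have "{\<gamma>. addable l L \<gamma>} \<subseteq> (\<Union>c\<in>{1..l}. \<Union>a\<in>{1..Suc (len (L c))}. {(a, Suc (L c a), c)})"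
  proof clarify
    fix a b c assume ad: "addable l L (a, b, c)"
    then have c: "c \<in> {1..l}" "1 \<le> a" by (auto simp: addable_iff[OF assms])
    have "a \<le> Suc (len (L c))"
    proof (cases "1 < a")
      case True
      then have "(a - 1, b, c) \<in> young l L" using ad by (auto simp: addable_iff[OF assms])
      then show ?thesis unfolding young_def by auto
    qed simp
    then show "(a, b, c) \<in> (\<Union>c\<in>{1..l}. \<Union>a\<in>{1..Suc (len (L c))}. {(a, Suc (L c a), c)})"
      using c addable_row[OF assms ad] by auto
  qed
  then show ?thesis by (rule finite_subset) auto
qed

section \<open>Rank as a number of nodes\<close>

lemma rank_eq_card:
  assumes "lpart l L"
  shows "rank l L = card (young l L)"
proof -
  have "young l L = (\<lambda>(c, a, b). (a, b, c)) `
      (SIGMA c:{1..l}. SIGMA a:{1..len (L c)}. {1..L c a})"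
    by (fastforce simp: young_def image_iff)
  then have "card (young l L) = card (SIGMA c:{1..l}. SIGMA a:{1..len (L c)}. {1..L c a})"
    by (simp add: card_image inj_on_def split_def prod_eq_iff)
  also have "\<dots> = rank l L" by (simp add: rank_def)
  finally show ?thesis by simp
qed

text \<open>A node (a, b, c) forces a nodes in the first column and b nodes in the first row of its
  component, so every diagram with n nodes fits into one finite box. Finiteness matters because a
  sum over an infinite index set would be 0 by convention.\<close>

lemma finite_lpart_rank: "finite {M. lpart l M \<and> rank l M = n}"
proof (rule finite_imageD[where f = "young l"])
  have "(a, b, c) \<in> {1..n} \<times> {1..n} \<times> {1..l}"
    if M: "lpart l M" "rank l M = n" and y: "(a, b, c) \<in> young l M" for M a b c
  proof -
    have pos: "1 \<le> a" "1 \<le> b" "c \<in> {1..l}" using y by (auto simp: mem_young[OF M(1)])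
    have "(\<lambda>x. (x, 1, c)) ` {1..a} \<subseteq> young l M" "(\<lambda>x. (1, x, c)) ` {1..b} \<subseteq> young l M"
      using y pos by (auto intro: diagram_closed[OF diagram_young[OF M(1)]])
    from this[THEN card_mono[OF finite_young]] show ?thesis
      using pos M(2) rank_eq_card[OF M(1)] by (simp add: card_image inj_on_def)
  qed
  then have "young l M \<subseteq> {1..n} \<times> {1..n} \<times> {1..l}" if "lpart l M" "rank l M = n" for M
    using that by (auto simp: subset_iff)
  then have "young l ` {M. lpart l M \<and> rank l M = n} \<subseteq> Pow ({1..n} \<times> {1..n} \<times> {1..l})" by blast
  then show "finite (young l ` {M. lpart l M \<and> rank l M = n})" by (rule finite_subset) auto
  show "inj_on (young l) {M. lpart l M \<and> rank l M = n}"
    by (auto intro!: inj_onI young_inj)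
qed

section \<open>Nodes of a fixed residue and staggered sequences\<close>

definition addables :: "int \<Rightarrow> nat \<Rightarrow> (nat \<Rightarrow> int) \<Rightarrow> int \<Rightarrow> mpart \<Rightarrow> node set" where
  "addables e l s j L = {\<gamma>. addable l L \<gamma> \<and> residue e s \<gamma> = j}"

definition removables :: "int \<Rightarrow> nat \<Rightarrow> (nat \<Rightarrow> int) \<Rightarrow> int \<Rightarrow> mpart \<Rightarrow> node set" where
  "removables e l s j L = {\<gamma>. removable l L \<gamma> \<and> residue e s \<gamma> = j}"

text \<open>Numbers the places (content, component) of nodes of one residue consecutively by integers,
  in the order given by \<^const>\<open>node_less\<close>; see \<open>pos_co_less\<close>.\<close>

definition pos :: "int \<Rightarrow> nat \<Rightarrow> (nat \<Rightarrow> int) \<Rightarrow> node \<Rightarrow> int" where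
  "pos e l s \<gamma> = int l * (cont s \<gamma> div e) - int (component \<gamma>)"

definition add_nodes :: "nat \<Rightarrow> mpart \<Rightarrow> node set \<Rightarrow> mpart" where
  "add_nodes l L S = shape (young l L \<union> S)"

section \<open>Positions of the nodes of one residue\<close>

text \<open>The offsets \<open>c\<close> stay within a window of length \<open>k\<close>, so
  \<open>q\<close> acts as the leading digit and \<open>c\<close>, reversed, as the last
  one.\<close>

lemma mult_minus_less_iff:
  fixes q q' k c c' :: int
  assumes "c \<in> {1..k}" "c' \<in> {1..k}"
  shows "k * q - c < k * q' - c' \<longleftrightarrow> q < q' \<or> q = q' \<and> c' < c"
proof -
  have *: "k * x - a < k * y - b" if "x < y" "a \<in> {1..k}" "b \<in> {1..k}" for x y a b :: int
  proof -
    have "k * (x + 1) \<le> k * y" using that by (intro mult_left_mono) auto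
    then show ?thesis using that by (simp add: algebra_simps)
  qed
  show ?thesis using *[of q q' c c'] *[of q' q c' c] assms by (cases q q' rule: linorder_cases) auto
qed

text \<open>Contents of equal residue differ by a multiple of \<open>e\<close>, hence the quotients
  by \<open>e\<close> carry the whole comparison.\<close>

lemma residue_cong_div:
  assumes "e > 0" "residue e s x = residue e s y"
  shows "cont s x < cont s y \<longleftrightarrow> cont s x div e < cont s y div e"
    and "cont s x = cont s y \<longleftrightarrow> cont s x div e = cont s y div e"
proof -
  have d: "cont s z = e * (cont s z div e) + residue e s z" for z
    unfolding residue_def by simp
  have "cont s x < cont s y \<longleftrightarrow> e * (cont s x div e) < e * (cont s y div e)"
    using d[of x] d[of y] assms(2) by linarith
  then show "cont s x < cont s y \<longleftrightarrow> cont s x div e < cont s y div e"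
    using assms(1) by simp
  show "cont s x = cont s y \<longleftrightarrow> cont s x div e = cont s y div e"
    using d[of x] d[of y] assms(2) by metis
qed

lemma node_less_iff_pos:
  assumes "e > 0" "residue e s x = residue e s y" "component x \<in> {1..l}" "component y \<in> {1..l}"
  shows "node_less s x y \<longleftrightarrow> pos e l s x < pos e l s y"
  unfolding node_less_def pos_def residue_cong_div[OF assms(1,2)]
  using assms(3,4) by (subst mult_minus_less_iff) auto

lemma pos_eq_iff:
  assumes "e > 0" "residue e s x = residue e s y" "component x \<in> {1..l}" "component y \<in> {1..l}"
  shows "pos e l s x = pos e l s y \<longleftrightarrow> cont s x = cont s y \<and> component x = component y"
  using node_less_iff_pos[OF assms] node_less_iff_pos[OF assms(1) assms(2)[symmetric] assms(4,3)]
  unfolding node_less_def by (metis linorder_neq_iff)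

lemma pos_co_less:
  assumes "e > 0" "co_less e l s x y"
  shows "pos e l s y = pos e l s x + 1"
proof -
  have "cont s y div e = cont s x div e + 1" if "cont s x + e = cont s y"
    using that assms(1) by (metis div_add_self2 less_irrefl)
  then show ?thesis
    using assms(2) unfolding co_less_def pos_def by (auto simp: algebra_simps)
qed

text \<open>The contents differ by 1 and \<open>e\<close> exceeds 1. This is what keeps nodes of one
  residue from influencing each other when some of them are added or removed.\<close>

lemma residue_neighbour:
  assumes "e > 1"
  shows "residue e s (Suc a, b, c) \<noteq> residue e s (a, b, c)"
    "residue e s (a, Suc b, c) \<noteq> residue e s (a, b, c)"
proof -
  have "\<not> e dvd 1" "\<not> e dvd - 1" using assms by auto
  moreover have "e dvd cont s (Suc a, b, c) - cont s (a, b, c) \<longleftrightarrow> e dvd - 1"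
    "e dvd cont s (a, Suc b, c) - cont s (a, b, c) \<longleftrightarrow> e dvd 1"
    by simp_all
  ultimately show "residue e s (Suc a, b, c) \<noteq> residue e s (a, b, c)"
    "residue e s (a, Suc b, c) \<noteq> residue e s (a, b, c)"
    unfolding residue_def mod_eq_dvd_iff by blast+
qed

section \<open>Boundary and addable nodes on a diagonal\<close>

lemma component_young_ext: "\<gamma> \<in> young_ext l L \<Longrightarrow> component \<gamma> \<in> {1..l}"
  unfolding young_ext_def virtual_def young_def by auto

lemma component_removable: "removable l L \<gamma> \<Longrightarrow> component \<gamma> \<in> {1..l}"
proof -
  assume "removable l L \<gamma>"
  then have "\<gamma> \<in> young l L" unfolding removable_def by blast
  then show ?thesis unfolding young_def by auto
qed

lemma component_boundary: "\<gamma> \<in> boundary l L \<Longrightarrow> component \<gamma> \<in> {1..l}"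
  using component_young_ext[of \<gamma> l L] unfolding boundary_def vboundary_def hboundary_def by auto

lemma young_ext_iff:
  assumes "lpart l L"
  shows "(a, b, c) \<in> young_ext l L \<longleftrightarrow> (a, b, c) \<in> young l L \<or>
    c \<in> {1..l} \<and> (a = 0 \<and> (1, b, c) \<notin> young l L \<and> 1 \<le> b \<or>
      b = 0 \<and> (a, 1, c) \<notin> young l L \<and> 1 \<le> a)"
proof -
  have "len (L c) < a \<longleftrightarrow> 1 \<le> a \<and> L c a = 0" if "c \<in> {1..l}"
  proof (cases "1 \<le> a")
    case True
    then show ?thesis using that assms le_len_iff[of "L c" a] unfolding lpart_def by force
  qed auto
  then show ?thesis
    unfolding young_ext_def virtual_def by (auto simp: mem_young[OF assms])
qed

lemma boundary_iff:
  assumes "lpart l L"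
  shows "(a, b, c) \<in> boundary l L \<longleftrightarrow> (a, b, c) \<in> young_ext l L \<and>
    ((a, Suc b, c) \<notin> young_ext l L \<or> (Suc a, b, c) \<notin> young_ext l L)"
  unfolding boundary_def vboundary_def hboundary_def by auto

text \<open>A node further down the diagonal would force the right and the lower neighbour of (a, b)
  into the diagram, so that (a, b) could not lie on the boundary.\<close>

lemma boundary_same_diagonal:
  assumes L: "lpart l L" and 1: "(a, b, c) \<in> boundary l L"
    and 2: "(a + k, b + k, c) \<in> boundary l L"
  shows "k = 0"
proof (rule ccontr)
  assume k: "k \<noteq> 0"
  have y: "(a, b, c) \<in> young_ext l L" and
    nb: "(a, Suc b, c) \<notin> young_ext l L \<or> (Suc a, b, c) \<notin> young_ext l L"
    using 1 unfolding boundary_iff[OF L] by simp_all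
  have yk: "(a + k, b + k, c) \<in> young l L"
  proof -
    have "(a + k, b + k, c) \<in> young_ext l L" using 2 unfolding boundary_iff[OF L] by simp
    then show ?thesis using k unfolding young_ext_iff[OF L] by simp
  qed
  have *: "(a', b', c) \<in> young l L" if "1 \<le> a'" "a' \<le> Suc a" "1 \<le> b'" "b' \<le> Suc b" for a' b'
    by (rule diagram_closed[OF diagram_young[OF L] yk]) (use that k in auto)
  have "(1, b, c) \<in> young l L" if "1 \<le> b" using that * by simp
  moreover have "(a, 1, c) \<in> young l L" if "1 \<le> a" using that * by simp
  moreover have "(a, b, c) \<in> young l L \<Longrightarrow> 1 \<le> a \<and> 1 \<le> b" unfolding mem_young[OF L] by simp
  \<comment> \<open>A virtual (a, b) would require that the node next to it in the first row or
    column be absent, against the facts just shown.\<close>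
  ultimately have "1 \<le> a \<and> 1 \<le> b"
    using y unfolding young_ext_iff[OF L] by blast
  then have "(a, Suc b, c) \<in> young l L" "(Suc a, b, c) \<in> young l L" using * by simp_all
  then show False using nb unfolding young_ext_iff[OF L] by blast
qed

lemma boundary_unique:
  assumes L: "lpart l L" and "x \<in> boundary l L" "y \<in> boundary l L"
    and "cont s x = cont s y" "component x = component y"
  shows "x = y"
proof -
  obtain a b c where x: "x = (a, b, c)" by (cases x)
  obtain a' b' where y: "y = (a', b', c)" using assms(5) x by (cases y) auto
  have c: "int b - int a = int b' - int a'" using assms(4) x y by simp
  show ?thesis
  proof (cases "a \<le> a'")
    case True
    then have "a' = a + (a' - a)" "b' = b + (a' - a)" using c by linarith+
    then show ?thesis
      using boundary_same_diagonal[OF L, of a b c "a' - a"] assms(2,3) x y by simp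
  next
    case False
    then have "a = a' + (a - a')" "b = b' + (a - a')" using c by linarith+
    then show ?thesis
      using boundary_same_diagonal[OF L, of a' b' c "a - a'"] assms(2,3) x y by simp
  qed
qed

text \<open>An addable node is the first gap on its diagonal. A boundary node beyond it would force
  it into the diagram; a boundary node before it would have both its right and its lower neighbour
  in the diagram.\<close>

lemma addable_boundary_diagonal:
  assumes L: "lpart l L" and x: "addable l L x" and y: "y \<in> boundary l L"
  shows "cont s x \<noteq> cont s y \<or> component x \<noteq> component y"
proof (rule ccontr)
  assume eq: "\<not> ?thesis"
  obtain a b c where x_eq: "x = (a, b, c)" by (cases x)
  obtain a' b' where y_eq: "y = (a', b', c)" using eq x_eq by (cases y) auto
  have ad: "1 \<le> a" "1 \<le> b" "c \<in> {1..l}" "(a, b, c) \<notin> young l L"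
    "1 < a \<Longrightarrow> (a - 1, b, c) \<in> young l L" "1 < b \<Longrightarrow> (a, b - 1, c) \<in> young l L"
    using x x_eq addable_iff[OF L] by auto
  have less: "(u, v, c) \<in> young l L" if "1 \<le> u" "u \<le> a" "1 \<le> v" "v \<le> b" "(u, v) \<noteq> (a, b)" for u v
  proof (cases "u = a")
    case True
    then have "1 < b" "v \<le> b - 1" using that by auto
    then show ?thesis
      using that True ad(6) diagram_closed[OF diagram_young[OF L], of a "b - 1" c u v] by simp
  next
    case False
    then have "1 < a" "u \<le> a - 1" using that by auto
    then show ?thesis
      using that ad(5) diagram_closed[OF diagram_young[OF L], of "a - 1" b c u v] by simp
  qed
  have bd: "(a', b', c) \<in> young_ext l L"
    "(a', Suc b', c) \<notin> young_ext l L \<or> (Suc a', b', c) \<notin> young_ext l L"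
    using y boundary_iff[OF L] y_eq by auto
  have diag: "int b - int a = int b' - int a'" using eq x_eq y_eq by simp
  show False
  proof (cases "a \<le> a'")
    case True
    then have "b \<le> b'" using diag by linarith
    then have "(a', b', c) \<in> young l L"
      using bd(1) True ad(1,2) unfolding young_ext_iff[OF L] by auto
    then show False
      using diagram_closed[OF diagram_young[OF L], of a' b' c a b] True \<open>b \<le> b'\<close> ad by auto
  next
    case False
    then have lt: "a' < a" "b' < b" using diag by linarith+
    have "(1, b', c) \<in> young l L" if "1 \<le> b'" using less[of 1 b'] that lt by auto
    moreover have "(a', 1, c) \<in> young l L" if "1 \<le> a'" using less[of a' 1] that lt by auto
    ultimately have "1 \<le> a' \<and> 1 \<le> b'"
      using bd(1) mem_young[OF L, of a' b' c] unfolding young_ext_iff[OF L] by blast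
    then have "(a', Suc b', c) \<in> young l L" "(Suc a', b', c) \<in> young l L"
      using lt by (auto intro!: less)
    then show False using bd(2) unfolding young_ext_iff[OF L] by blast
  qed
qed

lemma removable_imp_boundary:
  assumes L: "lpart l L" and "removable l L x"
  shows "x \<in> boundary l L"
proof -
  obtain a b c where x: "x = (a, b, c)" by (cases x)
  have "(a, b, c) \<in> young l L" "(a, Suc b, c) \<notin> young l L"
    using assms(2) x removable_iff[OF L] by auto
  then show ?thesis
    unfolding x boundary_iff[OF L] young_ext_iff[OF L] by (auto simp: mem_young[OF L])
qed

section \<open>Adding several addable nodes at once\<close>

text \<open>Addable nodes never depend on each other: adding one alone already gives a diagram, so
  everything above and to the left of it is old.\<close>

lemma diagram_add_nodes:
  assumes L: "lpart l L" and S: "S \<subseteq> {\<gamma>. addable l L \<gamma>}"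
  shows "diagram l (young l L \<union> S)"
  unfolding diagram_def
proof (intro conjI allI impI)
  show "finite (young l L \<union> S)"
    using finite_young finite_addable[OF L] S by (meson finite_UnI finite_subset)
  show "young l L \<union> S \<subseteq> {1..} \<times> {1..} \<times> {1..l}"
    using S diagram_young[OF L] unfolding diagram_def addable_def by blast
  fix a b c a' b'
  assume h: "(a, b, c) \<in> young l L \<union> S \<and> 1 \<le> a' \<and> a' \<le> a \<and> 1 \<le> b' \<and> b' \<le> b"
  show "(a', b', c) \<in> young l L \<union> S"
  proof (cases "(a, b, c) \<in> young l L")
    case True
    then show ?thesis using h diagram_closed[OF diagram_young[OF L]] by blast
  next
    case False
    then have "(a, b, c) \<in> S" using h by blast
    then have "diagram l (insert (a, b, c) (young l L))"
      using S unfolding addable_def diagram_iff by blast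
    then have "(a', b', c) \<in> insert (a, b, c) (young l L)"
      by (rule diagram_closed[of l _ a b c]) (use h in auto)
    then show ?thesis using \<open>(a, b, c) \<in> S\<close> by blast
  qed
qed

lemma
  assumes "lpart l L" "S \<subseteq> {\<gamma>. addable l L \<gamma>}"
  shows lpart_add_nodes: "lpart l (add_nodes l L S)"
    and young_add_nodes: "young l (add_nodes l L S) = young l L \<union> S"
  using lpart_shape young_shape diagram_add_nodes[OF assms] unfolding add_nodes_def by blast+

lemma addables_subset: "addables e l s j L \<subseteq> {\<gamma>. addable l L \<gamma>}"
  unfolding addables_def by blast

lemma rank_add_nodes:
  assumes "lpart l L" "S \<subseteq> {\<gamma>. addable l L \<gamma>}"
  shows "rank l (add_nodes l L S) = rank l L + card S"
proof -
  have "finite S" using assms finite_addable finite_subset by blast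
  moreover have "young l L \<inter> S = {}" using assms(2) unfolding addable_def by blast
  ultimately show ?thesis
    using rank_eq_card[OF lpart_add_nodes[OF assms]] rank_eq_card[OF assms(1)]
    by (simp add: young_add_nodes[OF assms] card_Un_disjoint finite_young)
qed

text \<open>A row offers only one addable place, just behind its end. This is the form in which
  additions enter the lexicographic comparison.\<close>

lemma add_nodes_row:
  assumes L: "lpart l L" and S: "S \<subseteq> {\<gamma>. addable l L \<gamma>}"
  shows "add_nodes l L S c a = L c a + (if (a, Suc (L c a), c) \<in> S then 1 else 0)"
proof -
  have "add_nodes l L S c a = card ({b. (a, b, c) \<in> young l L} \<union> {b. (a, b, c) \<in> S})"
    unfolding add_nodes_def shape_def by (simp add: Collect_disj_eq)
  also have "{b. (a, b, c) \<in> S} = (if (a, Suc (L c a), c) \<in> S then {Suc (L c a)} else {})"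
    using S addable_row[OF L] by auto
  also have "card ({b. (a, b, c) \<in> young l L} \<union> \<dots>)
      = card {b. (a, b, c) \<in> young l L} + (if (a, Suc (L c a), c) \<in> S then 1 else 0)"
  proof (cases "(a, Suc (L c a), c) \<in> S")
    case True
    have "finite {b. (a, b, c) \<in> young l L}"
      by (rule finite_subset[of _ "{..L c a}"]) (auto simp: mem_young[OF L])
    moreover have "Suc (L c a) \<notin> {b. (a, b, c) \<in> young l L}" by (simp add: mem_young[OF L])
    ultimately show ?thesis using True by simp
  qed simp
  also have "card {b. (a, b, c) \<in> young l L} = L c a"
    using shape_young[OF L] unfolding shape_def by metis
  finally show ?thesis .
qed

text \<open>Neighbours of the added nodes have other residues, so among the j-nodes nothing becomes
  addable and nothing but \<open>S\<close> ceases to be.\<close>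

lemma addables_add_nodes:
  assumes L: "lpart l L" and e: "e > 1" and S: "S \<subseteq> addables e l s j L"
  shows "addables e l s j (add_nodes l L S) = addables e l s j L - S"
proof -
  have S': "S \<subseteq> {\<gamma>. addable l L \<gamma>}" using S addables_subset by blast
  have "(a, b, c) \<in> addables e l s j (add_nodes l L S) \<longleftrightarrow> (a, b, c) \<in> addables e l s j L - S"
    for a b c
  proof (cases "residue e s (a, b, c) = j")
    case True
    have "1 < a \<Longrightarrow> (a - 1, b, c) \<notin> S" "1 < b \<Longrightarrow> (a, b - 1, c) \<notin> S"
      using S True residue_neighbour(1)[OF e, of s "a - 1" b c]
        residue_neighbour(2)[OF e, of s a "b - 1" c]
      unfolding addables_def by auto
    then show ?thesis
      unfolding addables_def using True
      by (auto simp: addable_iff[OF lpart_add_nodes[OF L S']] addable_iff[OF L]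
          young_add_nodes[OF L S'])
  qed (simp add: addables_def)
  then show ?thesis by (metis subset_antisym subsetI prod_cases3)
qed

text \<open>An old removable j-node stays removable because its right and lower neighbours have
  other residues and are not in \<open>S\<close>; a new node is removable because nothing of the old
  diagram lies beyond it.\<close>

lemma removables_add_nodes:
  assumes L: "lpart l L" and e: "e > 1" and S: "S \<subseteq> addables e l s j L"
  shows "removables e l s j (add_nodes l L S) = removables e l s j L \<union> S"
proof -
  have S': "S \<subseteq> {\<gamma>. addable l L \<gamma>}" using S addables_subset by blast
  have "(a, b, c) \<in> removables e l s j (add_nodes l L S) \<longleftrightarrow> (a, b, c) \<in> removables e l s j L \<union> S"
    for a b c
  proof (cases "residue e s (a, b, c) = j")
    case True
    have "(Suc a, b, c) \<notin> S" "(a, Suc b, c) \<notin> S"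
      using S True residue_neighbour[OF e, of s] unfolding addables_def by auto
    moreover have "(Suc a, b, c) \<notin> young l L" "(a, Suc b, c) \<notin> young l L" if "(a, b, c) \<in> S"
    proof -
      have "1 \<le> a" "1 \<le> b" "(a, b, c) \<notin> young l L"
        using S' that addable_iff[OF L, of a b c] by auto
      then show "(Suc a, b, c) \<notin> young l L" "(a, Suc b, c) \<notin> young l L"
        using diagram_closed[OF diagram_young[OF L], of "Suc a" b c a b]
          diagram_closed[OF diagram_young[OF L], of a "Suc b" c a b] by auto
    qed
    ultimately show ?thesis
      unfolding removables_def using True
      by (auto simp: removable_iff[OF lpart_add_nodes[OF L S']] removable_iff[OF L]
          young_add_nodes[OF L S'])
  next
    case False
    then show ?thesis using S by (auto simp: removables_def addables_def)
  qed
  then show ?thesis by (metis subset_antisym subsetI prod_cases3)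
qed

section \<open>Staggered sequences in terms of positions\<close>

lemma staggered_seqD:
  assumes "staggered_seq e l s j L \<gamma>"
  shows "\<gamma> i \<in> boundary l L" "residue e s (\<gamma> i) = j" "co_less e l s (\<gamma> i) (\<gamma> (Suc i))"
  using assms unfolding staggered_seq_def by simp_all

text \<open>Co-consecutive nodes have consecutive positions, so a staggered sequence meets every
  position from its first one on.\<close>

lemma pos_staggered_seq:
  assumes "e > 0" "staggered_seq e l s j L \<gamma>"
  shows "pos e l s (\<gamma> i) = pos e l s (\<gamma> 0) + int i"
proof (induction i)
  case (Suc i)
  then show ?case using pos_co_less[OF assms(1) staggered_seqD(3)[OF assms(2)], of i] by simp
qed simp

lemma staggered_seq_meets:
  assumes "e > 0" "staggered_seq e l s j L \<gamma>" "residue e s x = j" "component x \<in> {1..l}"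
    and "pos e l s (\<gamma> 0) \<le> pos e l s x"
  obtains i where "cont s (\<gamma> i) = cont s x" "component (\<gamma> i) = component x"
proof
  define i where "i = nat (pos e l s x - pos e l s (\<gamma> 0))"
  have "pos e l s (\<gamma> i) = pos e l s x"
    using pos_staggered_seq[OF assms(1,2), of i] assms(5) by (simp add: i_def)
  moreover have "residue e s (\<gamma> i) = residue e s x" "component (\<gamma> i) \<in> {1..l}"
    using staggered_seqD[OF assms(2), of i] assms(3) component_boundary by auto
  ultimately show "cont s (\<gamma> i) = cont s x" "component (\<gamma> i) = component x"
    using pos_eq_iff[OF assms(1)] assms(4) by blast+
qed

lemma staggered_seq_addable_below:
  assumes "lpart l L" "e > 0" "staggered_seq e l s j L \<gamma>" "x \<in> addables e l s j L"
  shows "pos e l s x < pos e l s (\<gamma> 0)"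
proof (rule ccontr)
  assume "\<not> ?thesis"
  moreover have x: "addable l L x" "residue e s x = j" using assms(4) unfolding addables_def by auto
  ultimately obtain i where "cont s (\<gamma> i) = cont s x" "component (\<gamma> i) = component x"
    using staggered_seq_meets[OF assms(2,3), of x] component_addable by (metis linorder_not_less)
  moreover have "\<gamma> i \<in> boundary l L" by (rule staggered_seqD[OF assms(3)])
  ultimately show False using addable_boundary_diagonal[OF assms(1) x(1)] by metis
qed

text \<open>From its start on, the sequence meets the diagonal of every j-node; as a diagonal has
  only one boundary node, a removable node met there is itself a term and is removed.\<close>

lemma staggered_seq_removable_below:
  assumes "lpart l L" "e > 0" "staggered_seq e l s j L \<gamma>" "x \<in> removables e l s j L"
    and "x \<notin> removed_nodes l L \<gamma>"
  shows "pos e l s x < pos e l s (\<gamma> 0)"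
proof (rule ccontr)
  assume "\<not> ?thesis"
  moreover have x: "removable l L x" "residue e s x = j"
    using assms(4) unfolding removables_def by auto
  ultimately obtain i where "cont s (\<gamma> i) = cont s x" "component (\<gamma> i) = component x"
    using staggered_seq_meets[OF assms(2,3), of x] component_removable by (metis linorder_not_less)
  moreover have "\<gamma> i \<in> boundary l L" by (rule staggered_seqD[OF assms(3)])
  ultimately have "x = \<gamma> i"
    using boundary_unique[OF assms(1)] removable_imp_boundary[OF assms(1) x(1)] by metis
  then show False using assms(5) x(1) unfolding removed_nodes_def by blast
qed

lemma removed_nodes_pos:
  assumes "e > 0" "staggered_seq e l s j L \<gamma>" "x \<in> removed_nodes l L \<gamma>"
  shows "residue e s x = j" "pos e l s (\<gamma> 0) \<le> pos e l s x"
proof -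
  obtain i where i: "x = \<gamma> i" using assms(3) unfolding removed_nodes_def by auto
  show "residue e s x = j" unfolding i by (rule staggered_seqD[OF assms(2)])
  show "pos e l s (\<gamma> 0) \<le> pos e l s x"
    unfolding i using pos_staggered_seq[OF assms(1,2), of i] by simp
qed

text \<open>The removable nodes are part of the bound for three reasons: the leading coefficient is
  then 1, two successive steps cannot share a residue, and a tie in the lexicographic comparison can
  be resolved.\<close>

definition top_addables ::
  "int \<Rightarrow> nat \<Rightarrow> (nat \<Rightarrow> int) \<Rightarrow> int \<Rightarrow> mpart \<Rightarrow> node set \<Rightarrow> bool" where
  "top_addables e l s j M S \<longleftrightarrow> S \<subseteq> addables e l s j M \<and>
     (\<forall>x\<in>S. \<forall>y\<in>(addables e l s j M - S) \<union> removables e l s j M. pos e l s y < pos e l s x)"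

lemma staggered_step_top:
  assumes L: "lpart l L" and e: "e > 1" and st: "staggered_seq e l s j L \<gamma>"
    and M: "lpart l M" "young l M = young l L - removed_nodes l L \<gamma>"
  shows "top_addables e l s j M (removed_nodes l L \<gamma>)"
    and "L = add_nodes l M (removed_nodes l L \<gamma>)"
    and "removed_nodes l L \<gamma> \<noteq> {}"
proof -
  let ?S = "removed_nodes l L \<gamma>"
  have e0: "e > 0" using e by simp
  have res: "residue e s x = j" if "x \<in> ?S" for x by (rule removed_nodes_pos[OF e0 st that])
  have SL: "?S \<subseteq> young l L" unfolding removed_nodes_def removable_def by blast
  have S: "?S \<subseteq> addables e l s j M"
  proof (intro subsetI)
    fix x assume x: "x \<in> ?S"
    obtain a b c where abc: "x = (a, b, c)" by (cases x)
    have y: "(a, b, c) \<in> young l L" using x SL abc by blast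
    then have p: "1 \<le> a" "1 \<le> b" "c \<in> {1..l}" unfolding mem_young[OF L] by auto
    \<comment> \<open>The upper neighbour was present in \<open>L\<close> and, having another
      residue, was not removed; likewise for the left neighbour.\<close>
    have "(a - 1, b, c) \<in> young l M" if "1 < a"
    proof -
      have "(a - 1, b, c) \<notin> ?S"
        using res[of "(a - 1, b, c)"] res[OF x] abc that
          residue_neighbour(1)[OF e, of s "a - 1" b c] by auto
      moreover have "(a - 1, b, c) \<in> young l L"
        by (rule diagram_closed[OF diagram_young[OF L] y]) (use p that in auto)
      ultimately show ?thesis using M(2) by blast
    qed
    moreover have "(a, b - 1, c) \<in> young l M" if "1 < b"
    proof -
      have "(a, b - 1, c) \<notin> ?S"
        using res[of "(a, b - 1, c)"] res[OF x] abc that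
          residue_neighbour(2)[OF e, of s a "b - 1" c] by auto
      moreover have "(a, b - 1, c) \<in> young l L"
        by (rule diagram_closed[OF diagram_young[OF L] y]) (use p that in auto)
      ultimately show ?thesis using M(2) by blast
    qed
    ultimately show "x \<in> addables e l s j M"
      using p res[OF x] x abc M(2) unfolding addables_def by (auto simp: addable_iff[OF M(1)])
  qed
  have S': "?S \<subseteq> {\<gamma>. addable l M \<gamma>}" using S addables_subset by blast
  show Leq: "L = add_nodes l M ?S"
    using young_inj[OF L lpart_add_nodes[OF M(1) S']] young_add_nodes[OF M(1) S'] M(2) SL by blast
  have A: "addables e l s j L = addables e l s j M - ?S"
    using addables_add_nodes[OF M(1) e S] Leq by metis
  have "removables e l s j M \<union> ?S = removables e l s j L"
    using removables_add_nodes[OF M(1) e S] Leq by metis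
  moreover have "removables e l s j M \<inter> ?S = {}"
    using M(2) unfolding removables_def removable_def by blast
  ultimately have "pos e l s y < pos e l s (\<gamma> 0)"
    if "y \<in> (addables e l s j M - ?S) \<union> removables e l s j M" for y
    using that A staggered_seq_addable_below[OF L e0 st] staggered_seq_removable_below[OF L e0 st]
    by blast
  then show "top_addables e l s j M ?S"
    unfolding top_addables_def using S removed_nodes_pos(2)[OF e0 st] by (meson less_le_trans)
  show "?S \<noteq> {}" using st unfolding staggered_seq_def removed_nodes_def by blast
qed

text \<open>A removable term of the sequence lies at or above its start, which lies above every
  addable j-node, in particular above the nodes of \<open>S\<close>; yet these are above all
  removable j-nodes.\<close>

lemma staggered_residues_differ:
  assumes e: "e > 1" and M: "lpart l M" and top: "top_addables e l s j M S" "S \<noteq> {}"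
  shows "\<not> staggered_seq e l s j M \<gamma>"
proof
  assume st: "staggered_seq e l s j M \<gamma>"
  have e0: "e > 0" using e by simp
  obtain x where x: "x \<in> S" "x \<in> addables e l s j M" using top unfolding top_addables_def by blast
  obtain i where "removable l M (\<gamma> i)" "residue e s (\<gamma> i) = j"
    using st unfolding staggered_seq_def by blast
  then have "pos e l s (\<gamma> i) < pos e l s x"
    using top x unfolding top_addables_def removables_def by blast
  then show False
    using staggered_seq_addable_below[OF M e0 st x(2)] pos_staggered_seq[OF e0 st, of i] by linarith
qed

section \<open>Divided powers on basis vectors\<close>

definition above :: "int \<Rightarrow> nat \<Rightarrow> (nat \<Rightarrow> int) \<Rightarrow> node \<Rightarrow> node set \<Rightarrow> nat" where
  "above e l s x X = card {y \<in> X. pos e l s x < pos e l s y}"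

text \<open>The exponent of \<open>v\<close> for adding the single node \<open>x\<close>: the node \<open>x\<close> itself, removable afterwards, does
  not lie above \<open>x\<close>, and adding it does not change the other removable nodes of its residue.\<close>

definition excess :: "int \<Rightarrow> nat \<Rightarrow> (nat \<Rightarrow> int) \<Rightarrow> int \<Rightarrow> mpart \<Rightarrow> node \<Rightarrow> int" where
  "excess e l s j L x =
     int (above e l s x (addables e l s j L)) - int (above e l s x (removables e l s j L))"

section \<open>Linearity of the operators on the Fock space\<close>

lemma lookup_fock_scale [simp]:
  "Poly_Mapping.lookup (fock_scale x u) M = x * Poly_Mapping.lookup u M"
  unfolding fock_scale_def by (simp add: Poly_Mapping.map.rep_eq when_def)

lemma fock_scale_add: "fock_scale x (u + w) = fock_scale x u + fock_scale x w"
  by (rule poly_mapping_eqI) (simp add: lookup_add algebra_simps)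

lemma fock_scale_add_left: "fock_scale (x + y) u = fock_scale x u + fock_scale y u"
  by (rule poly_mapping_eqI) (simp add: lookup_add algebra_simps)

lemma fock_scale_zero [simp]: "fock_scale x 0 = 0" "fock_scale 0 u = 0"
  by (rule poly_mapping_eqI; simp)+

lemma fock_scale_fock_scale: "fock_scale x (fock_scale y u) = fock_scale (x * y) u"
  by (rule poly_mapping_eqI) simp

lemma fock_scale_single: "fock_scale x (Poly_Mapping.single M y) = Poly_Mapping.single M (x * y)"
  by (rule poly_mapping_eqI) (simp add: lookup_single when_def)

lemma fock_scale_sum: "fock_scale x (\<Sum>i\<in>I. u i) = (\<Sum>i\<in>I. fock_scale x (u i))"
  by (induction I rule: infinite_finite_induct) (simp_all add: fock_scale_add)

lemma single_sum: "(\<Sum>i\<in>I. Poly_Mapping.single M (g i)) = Poly_Mapping.single M (\<Sum>i\<in>I. g i)"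
  by (induction I rule: infinite_finite_induct) (simp_all add: single_add)

text \<open>Keys may cancel in a sum of vectors, so additivity is proved over a common finite index
  set instead of the exact supports.\<close>

lemma f_op_superset:
  assumes "finite K" "Poly_Mapping.keys u \<subseteq> K"
  shows "f_op e l s j u = (\<Sum>L\<in>K. fock_scale (Poly_Mapping.lookup u L) (f_basis e l s j L))"
  unfolding f_op_def
  by (rule sum.mono_neutral_left[OF assms]) (simp add: in_keys_iff)

lemma f_op_add: "f_op e l s j (u + w) = f_op e l s j u + f_op e l s j w"
proof -
  let ?K = "Poly_Mapping.keys u \<union> Poly_Mapping.keys w"
  have "f_op e l s j (u + w)
      = (\<Sum>L\<in>?K. fock_scale (Poly_Mapping.lookup (u + w) L) (f_basis e l s j L))"
    by (rule f_op_superset) (simp_all add: Poly_Mapping.keys_add)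
  also have "\<dots> = f_op e l s j u + f_op e l s j w"
    by (simp add: f_op_superset[of ?K u] f_op_superset[of ?K w] lookup_add fock_scale_add_left
        sum.distrib)
  finally show ?thesis .
qed

lemma f_op_scale: "f_op e l s j (fock_scale x u) = fock_scale x (f_op e l s j u)"
proof -
  have "Poly_Mapping.keys (fock_scale x u) \<subseteq> Poly_Mapping.keys u"
    by (auto simp: in_keys_iff)
  then have "f_op e l s j (fock_scale x u)
      = (\<Sum>L\<in>Poly_Mapping.keys u.
          fock_scale (Poly_Mapping.lookup (fock_scale x u) L) (f_basis e l s j L))"
    by (intro f_op_superset) simp_all
  also have "\<dots> = fock_scale x (f_op e l s j u)"
    by (simp add: f_op_def fock_scale_sum fock_scale_fock_scale)
  finally show ?thesis .
qed

lemma f_op_zero [simp]: "f_op e l s j 0 = 0"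
  by (simp add: f_op_def)

lemma f_op_sum: "f_op e l s j (\<Sum>i\<in>I. u i) = (\<Sum>i\<in>I. f_op e l s j (u i))"
  by (induction I rule: infinite_finite_induct) (simp_all add: f_op_add)

lemma f_op_single:
  "f_op e l s j (Poly_Mapping.single L x) = fock_scale x (f_basis e l s j L)"
  using f_op_superset[of "{L}" "Poly_Mapping.single L x"] by simp

lemma fock_expand:
  fixes u :: fock
  shows "u = (\<Sum>L\<in>Poly_Mapping.keys u.
    fock_scale (Poly_Mapping.lookup u L) (Poly_Mapping.single L 1))"
  by (rule poly_mapping_eqI)
     (simp add: lookup_sum fock_scale_single lookup_single when_def in_keys_iff)

lemma f_divpow_expand:
  "f_divpow e l s j r u = (\<Sum>L\<in>Poly_Mapping.keys u.
     fock_scale (Poly_Mapping.lookup u L) (f_divpow e l s j r (Poly_Mapping.single L 1)))"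
proof -
  have pow_sum: "(f_op e l s j ^^ r) (\<Sum>i\<in>I. g i) = (\<Sum>i\<in>I. (f_op e l s j ^^ r) (g i))"
    for I :: "mpart set" and g by (induction r) (simp_all add: f_op_sum)
  have pow_scale: "(f_op e l s j ^^ r) (fock_scale x w) = fock_scale x ((f_op e l s j ^^ r) w)"
    for x w by (induction r) (simp_all add: f_op_scale)
  have "f_divpow e l s j r u = f_divpow e l s j r (\<Sum>L\<in>Poly_Mapping.keys u.
      fock_scale (Poly_Mapping.lookup u L) (Poly_Mapping.single L 1))"
    using fock_expand[of u] by simp
  also have "\<dots> = (\<Sum>L\<in>Poly_Mapping.keys u.
     fock_scale (Poly_Mapping.lookup u L) (f_divpow e l s j r (Poly_Mapping.single L 1)))"
    by (simp add: f_divpow_def pow_sum pow_scale fock_scale_sum fock_scale_fock_scale mult.commute)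
  finally show ?thesis .
qed

section \<open>Quantum integers and factorials\<close>

lemma qv_nonzero [simp]: "qv \<noteq> 0"
  unfolding qv_def by simp

lemma qv_power: "qv ^ k = to_fract ([:0, 1:] ^ k)"
  unfolding qv_def by (induction k) (simp_all only: power_0 power_Suc to_fract_1 to_fract_mult)

text \<open>By degree, v is not a root of unity; hence quantum integers are nonzero and the division
  by \<open>qfact\<close> is genuine.\<close>

lemma qv_power_neq_1:
  assumes "k > 0"
  shows "qv ^ k \<noteq> 1"
proof
  assume "qv ^ k = 1"
  then have "to_fract ([:0, 1::rat:] ^ k) = to_fract 1" by (simp add: qv_power)
  then have "[:0, 1::rat:] ^ k = 1" using to_fract_eq_iff by blast
  then have "degree ([:0, 1::rat:] ^ k) = 0" by simp
  then show False using assms by (simp add: degree_power_eq)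
qed

lemma qv_minus_inverse_nonzero: "qv powi int m - qv powi (- int m) \<noteq> 0" if "m > 0"
proof
  assume "qv powi int m - qv powi (- int m) = 0"
  then have "qv powi int m * qv powi int m = qv powi (- int m) * qv powi int m" by simp
  moreover have "qv powi (- int m) * qv powi int m = 1" by (simp add: power_int_minus)
  ultimately have "qv ^ (m + m) = 1" by (simp add: power_add)
  then show False using qv_power_neq_1[of "m + m"] that by simp
qed

lemma qint_nonzero: "m > 0 \<Longrightarrow> qint m \<noteq> 0"
  using qv_minus_inverse_nonzero[of m] qv_minus_inverse_nonzero[of 1] unfolding qint_def by simp

lemma qfact_nonzero: "qfact k \<noteq> 0"
  unfolding qfact_def using qint_nonzero by simp

lemma qfact_Suc: "qfact (Suc k) = qfact k * qint (Suc k)"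
  unfolding qfact_def by simp

text \<open>The asymmetric form is the one that arises when one of r + 1 nodes is chosen to be added
  last: k counts the chosen nodes above it. Multiplied by v - 1/v, the sum telescopes.\<close>

lemma qint_Suc_eq_sum: "qint (Suc r) = qv powi int r * (\<Sum>k<Suc r. qv powi (- 2 * int k))"
proof -
  let ?d = "qv - qv powi (-1)"
  have d: "?d \<noteq> 0" using qv_minus_inverse_nonzero[of 1] by simp
  have "?d * (qv powi int r * (\<Sum>k<Suc r. qv powi (- 2 * int k)))
      = (\<Sum>k<Suc r. qv powi (int r + 1 - 2 * int k) - qv powi (int r + 1 - 2 * int (Suc k)))"
    unfolding sum_distrib_left
  proof (rule sum.cong[OF refl])
    fix k
    have "?d * (qv powi int r * qv powi (- 2 * int k))
        = qv powi 1 * qv powi int r * qv powi (- 2 * int k)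
          - qv powi (-1) * qv powi int r * qv powi (- 2 * int k)"
      by (simp only: power_int_1_right algebra_simps)
    also have "\<dots> = qv powi (1 + int r + - 2 * int k) - qv powi (- 1 + int r + - 2 * int k)"
      by (simp only: power_int_add qv_nonzero simp_thms)
    also have "1 + int r + - 2 * int k = int r + 1 - 2 * int k" by simp
    also have "- 1 + int r + - 2 * int k = int r + 1 - 2 * int (Suc k)" by simp
    finally show "?d * (qv powi int r * qv powi (- 2 * int k))
      = qv powi (int r + 1 - 2 * int k) - qv powi (int r + 1 - 2 * int (Suc k))" .
  qed
  also have "\<dots> = qv powi (int r + 1 - 2 * int 0) - qv powi (int r + 1 - 2 * int (Suc r))"
    by (rule sum_lessThan_telescope')
  also have "\<dots> = qv powi int (Suc r) - qv powi (- int (Suc r))"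
    by (simp add: add.commute)
  finally show ?thesis unfolding qint_def using d by (simp add: field_simps)
qed

section \<open>The action on a basis vector\<close>

lemma above_insert_self: "above e l s x (insert x X) = above e l s x X"
  unfolding above_def by (rule arg_cong[where f = card]) auto

text \<open>On a diagonal a lower row would have to reach further right, whereas row lengths do not
  increase.\<close>

lemma addables_pos_inj:
  assumes L: "lpart l L" and e: "e > 0"
  shows "inj_on (pos e l s) (addables e l s j L)"
proof (rule inj_onI)
  fix x y assume x: "x \<in> addables e l s j L" and y: "y \<in> addables e l s j L"
    and eq: "pos e l s x = pos e l s y"
  have ad: "addable l L x" "addable l L y" and res: "residue e s x = residue e s y"
    using x y unfolding addables_def by auto
  have ce: "cont s x = cont s y" "component x = component y"
    using eq pos_eq_iff[OF e res] ad component_addable by metis+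
  obtain a b c where xe: "x = (a, b, c)" by (cases x)
  obtain a' b' where ye: "y = (a', b', c)" using ce(2) xe by (cases y) auto
  have b: "b = Suc (L c a)" "b' = Suc (L c a')" using addable_row[OF L] ad xe ye by blast+
  have a1: "1 \<le> a" "1 \<le> a'" using ad xe ye unfolding addable_def by auto
  have "a \<le> a' \<Longrightarrow> b' \<le> b" "a' \<le> a \<Longrightarrow> b \<le> b'"
    using lpart_antimono[OF L a1(1), of a' c] lpart_antimono[OF L a1(2), of a c] b by auto
  moreover have "int b - int a = int b' - int a'" using ce(1) xe ye by simp
  ultimately have "a = a'" by linarith
  then show "x = y" using xe ye b by simp
qed

lemma finite_addables: "lpart l L \<Longrightarrow> finite (addables e l s j L)"
  using finite_subset[OF addables_subset finite_addable] .

lemma finite_removables: "finite (removables e l s j L)"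
  by (rule finite_subset[OF _ finite_young[of l L]]) (auto simp: removables_def removable_def)

lemma add_nodes_add_nodes:
  assumes "lpart l L" "S \<subseteq> {\<gamma>. addable l L \<gamma>}"
  shows "add_nodes l (add_nodes l L S) T = add_nodes l L (S \<union> T)"
  unfolding add_nodes_def[of l "add_nodes l L S"] young_add_nodes[OF assms]
  by (simp add: add_nodes_def Un_assoc)

lemma add_nodes_inj:
  assumes L: "lpart l L" and S: "S \<subseteq> {\<gamma>. addable l L \<gamma>}" and T: "T \<subseteq> {\<gamma>. addable l L \<gamma>}"
    and eq: "add_nodes l L S = add_nodes l L T"
  shows "S = T"
proof -
  have "young l L \<inter> S = {}" "young l L \<inter> T = {}" using S T unfolding addable_def by blast+
  moreover have "young l L \<union> S = young l L \<union> T"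
    using young_add_nodes[OF L S] young_add_nodes[OF L T] eq by simp
  ultimately show ?thesis by blast
qed

lemma adds_node_iff:
  assumes L: "lpart l L"
  shows "adds_node e l s j L M x \<longleftrightarrow> x \<in> addables e l s j L \<and> M = add_nodes l L {x}"
proof
  assume a: "adds_node e l s j L M x"
  then have M: "lpart l M" "young l M = insert x (young l L)" "x \<notin> young l L" "residue e s x = j"
    unfolding adds_node_def by blast+
  have "x \<in> young l M" using M by simp
  then have "x \<in> {1..} \<times> {1..} \<times> {1..l}" using diagram_young[OF M(1)] unfolding diagram_def by blast
  then have x: "x \<in> addables e l s j L" unfolding addables_def addable_def using M by blast
  then have "{x} \<subseteq> {\<gamma>. addable l L \<gamma>}" unfolding addables_def by simp
  from young_inj[OF M(1) lpart_add_nodes[OF L this]] young_add_nodes[OF L this]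
  show "x \<in> addables e l s j L \<and> M = add_nodes l L {x}" using x M(2) by simp
next
  assume a: "x \<in> addables e l s j L \<and> M = add_nodes l L {x}"
  then have x: "{x} \<subseteq> {\<gamma>. addable l L \<gamma>}" "residue e s x = j" unfolding addables_def by auto
  then show "adds_node e l s j L M x"
    unfolding adds_node_def using a lpart_add_nodes[OF L x(1)] young_add_nodes[OF L x(1)]
    by (simp add: addable_def)
qed

lemma N_exp_add_nodes:
  assumes L: "lpart l L" and e: "e > 1" and x: "x \<in> addables e l s j L"
  shows "N_exp e l s j L (add_nodes l L {x}) = excess e l s j L x"
proof -
  have e0: "e > 0" using e by simp
  have xa: "addable l L x" and xr: "residue e s x = j" using x unfolding addables_def by auto
  have xc: "component x \<in> {1..l}" by (rule component_addable[OF xa])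
  have xs: "{x} \<subseteq> {\<gamma>. addable l L \<gamma>}" using xa by simp
  have the: "(THE \<gamma>. adds_node e l s j L (add_nodes l L {x}) \<gamma>) = x"
  proof (rule the_equality)
    show "adds_node e l s j L (add_nodes l L {x}) x" using adds_node_iff[OF L] x by blast
    fix y assume "adds_node e l s j L (add_nodes l L {x}) y"
    then have "{y} \<subseteq> {\<gamma>. addable l L \<gamma>}" "add_nodes l L {x} = add_nodes l L {y}"
      unfolding adds_node_iff[OF L] addables_def by auto
    from add_nodes_inj[OF L xs this] show "y = x" by simp
  qed
  have "{y. addable l L y \<and> residue e s y = j \<and> node_less s x y}
      = {y \<in> addables e l s j L. pos e l s x < pos e l s y}"
    using node_less_iff_pos[OF e0] xr xc component_addable unfolding addables_def by blast
  moreover have "{y. removable l (add_nodes l L {x}) y \<and> residue e s y = j \<and> node_less s x y}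
      = {y \<in> removables e l s j (add_nodes l L {x}). pos e l s x < pos e l s y}"
    using node_less_iff_pos[OF e0] xr xc component_removable unfolding removables_def by blast
  moreover have "removables e l s j (add_nodes l L {x}) = insert x (removables e l s j L)"
    using removables_add_nodes[OF L e, of "{x}" s j] x by simp
  ultimately show ?thesis
    unfolding N_exp_def the Let_def excess_def using above_insert_self[of e l s x]
    by (simp add: above_def)
qed

lemma f_basis_eq:
  assumes L: "lpart l L" and e: "e > 1"
  shows "f_basis e l s j L = (\<Sum>x\<in>addables e l s j L.
    Poly_Mapping.single (add_nodes l L {x}) (qv powi excess e l s j L x))"
proof -
  have "inj_on (\<lambda>x. add_nodes l L {x}) (addables e l s j L)"
    using add_nodes_inj[OF L, of "{x}" "{y}" for x y] unfolding addables_def inj_on_def by simp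
  moreover have "{M. \<exists>x. adds_node e l s j L M x} = (\<lambda>x. add_nodes l L {x}) ` addables e l s j L"
    using adds_node_iff[OF L] by blast
  ultimately show ?thesis
    unfolding f_basis_def by (simp add: sum.reindex N_exp_add_nodes[OF L e])
qed

text \<open>Each node of \<open>S\<close> above \<open>x\<close> is lost as addable and gained as
  removable, hence the factor 2.\<close>

lemma excess_add_nodes:
  assumes L: "lpart l L" and e: "e > 1" and S: "S \<subseteq> addables e l s j L"
  shows "excess e l s j (add_nodes l L S) x = excess e l s j L x - 2 * int (above e l s x S)"
proof -
  let ?up = "\<lambda>X. {y \<in> X. pos e l s x < pos e l s y}"
  have A: "finite (addables e l s j L)" using finite_addables[OF L] .
  have "removables e l s j L \<inter> addables e l s j L = {}"
    unfolding removables_def addables_def removable_def addable_def by blast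
  then have "?up (removables e l s j L) \<inter> ?up S = {}" using S by blast
  moreover have "?up (removables e l s j L \<union> S) = ?up (removables e l s j L) \<union> ?up S" by blast
  moreover have fin: "finite (?up (removables e l s j L))" "finite (?up S)"
    using finite_removables finite_subset[OF S A] by auto
  ultimately have 1: "above e l s x (removables e l s j L \<union> S)
      = above e l s x (removables e l s j L) + above e l s x S"
    unfolding above_def by (simp add: card_Un_disjoint)
  have "?up (addables e l s j L - S) = ?up (addables e l s j L) - ?up S" by blast
  moreover have sub: "?up S \<subseteq> ?up (addables e l s j L)" using S by blast
  moreover have "card (?up S) \<le> card (?up (addables e l s j L))"
    using A sub by (intro card_mono) auto
  ultimately have 2: "int (above e l s x (addables e l s j L - S))
      = int (above e l s x (addables e l s j L)) - int (above e l s x S)"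
    unfolding above_def using fin by (simp add: card_Diff_subset of_nat_diff)
  show ?thesis
    unfolding excess_def addables_add_nodes[OF L e S] removables_add_nodes[OF L e S] 1 2 by simp
qed

text \<open>Positions order \<open>X\<close> linearly, so the number of elements above takes each of
  the values 0, ..., \<open>card X\<close> - 1 exactly once.\<close>

lemma sum_above:
  fixes g :: "nat \<Rightarrow> 'a::comm_monoid_add"
  assumes "finite X" "inj_on (pos e l s) X"
  shows "(\<Sum>x\<in>X. g (above e l s x X)) = (\<Sum>k<card X. g k)"
proof -
  have "(\<Sum>p\<in>P. g (card {q \<in> P. p < q})) = (\<Sum>k<card P. g k)" if "finite P" for P :: "int set"
    using that
  \<comment> \<open>A new minimum has all the old elements above it and leaves their own counts
    unchanged.\<close>
  proof (induction P rule: finite_linorder_min_induct)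
    case (insert m P)
    have "{q \<in> insert m P. m < q} = P" using insert by auto
    moreover have "{q \<in> insert m P. p < q} = {q \<in> P. p < q}" if "p \<in> P" for p
      using insert that by auto
    moreover have "m \<notin> P" using insert by auto
    ultimately have "(\<Sum>p\<in>insert m P. g (card {q \<in> insert m P. p < q}))
        = g (card P) + (\<Sum>p\<in>P. g (card {q \<in> P. p < q}))"
      using insert.hyps(1) by (simp del: insert_iff cong: sum.cong)
    then show ?case using insert \<open>m \<notin> P\<close> by (simp add: add.commute)
  qed simp
  from this[of "pos e l s ` X"]
  have "(\<Sum>x\<in>X. g (card {q \<in> pos e l s ` X. pos e l s x < q})) = (\<Sum>k<card X. g k)"
    using assms by (simp add: sum.reindex card_image)
  moreover have "card {q \<in> pos e l s ` X. pos e l s x < q} = above e l s x X" for x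
  proof -
    have "{q \<in> pos e l s ` X. pos e l s x < q} = pos e l s ` {y \<in> X. pos e l s x < pos e l s y}"
      by blast
    then show ?thesis
      unfolding above_def using card_image[OF inj_on_subset[OF assms(2)]] by simp
  qed
  ultimately show ?thesis by simp
qed

abbreviation node_choices :: "int \<Rightarrow> nat \<Rightarrow> (nat \<Rightarrow> int) \<Rightarrow> int \<Rightarrow> mpart \<Rightarrow> nat \<Rightarrow> node set set" where
  "node_choices e l s j L r \<equiv> {S. S \<subseteq> addables e l s j L \<and> card S = r}"

text \<open>Adding the nodes of \<open>S\<close> in a given order contributes \<open>v\<close> to the sum of the excesses minus twice
  the number of inversions of that order.  Summing over all orders yields the quantum factorial of
  \<open>card S\<close> times \<open>v\<close> to the minus \<open>card S choose 2\<close>, whence the correction term.\<close>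

definition choice_exp :: "int \<Rightarrow> nat \<Rightarrow> (nat \<Rightarrow> int) \<Rightarrow> int \<Rightarrow> mpart \<Rightarrow> node set \<Rightarrow> int" where
  "choice_exp e l s j L S = (\<Sum>x\<in>S. excess e l s j L x) - (\<Sum>k<card S. int k)"

text \<open>Double counting: a set S of r nodes with a further node x is the same as a set T of r +
  1 nodes with a member x, the one added last.\<close>

lemma f_op_power_single:
  assumes L: "lpart l L" and e: "e > 1"
  shows "(f_op e l s j ^^ r) (Poly_Mapping.single L 1) = (\<Sum>S\<in>node_choices e l s j L r.
    Poly_Mapping.single (add_nodes l L S) (qfact r * qv powi choice_exp e l s j L S))"
proof (induction r)
  case 0
  have "add_nodes l L {} = L" unfolding add_nodes_def using shape_young[OF L] by simp
  moreover have "node_choices e l s j L 0 = {{}}"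
  proof -
    have "S \<subseteq> addables e l s j L \<and> card S = 0 \<longleftrightarrow> S = {}" for S
      using finite_subset[OF _ finite_addables[OF L], of S e s j]
      by (metis card_0_eq card.empty empty_subsetI)
    then show ?thesis by simp
  qed
  ultimately show ?case by (simp add: qfact_def choice_exp_def)
next
  case (Suc r)
  let ?A = "addables e l s j L" and ?x = "excess e l s j L" and ?v = "\<lambda>S. choice_exp e l s j L S"
  have A: "finite ?A" using finite_addables[OF L] .
  have step: "f_op e l s j (Poly_Mapping.single (add_nodes l L S) (qfact r * qv powi ?v S))
      = (\<Sum>x\<in>?A - S. Poly_Mapping.single (add_nodes l L (insert x S))
          (qfact r * qv powi (?v S + ?x x - 2 * int (above e l s x S))))"
    if "S \<in> node_choices e l s j L r" for S
  proof -
    have S: "S \<subseteq> ?A" using that by simp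
    then have S': "S \<subseteq> {\<gamma>. addable l L \<gamma>}" using addables_subset by blast
    note LS = lpart_add_nodes[OF L S']
    show ?thesis
      unfolding f_op_single f_basis_eq[OF LS e] addables_add_nodes[OF L e S] fock_scale_sum
        fock_scale_single excess_add_nodes[OF L e S]
    proof (rule sum.cong[OF refl])
      fix x assume "x \<in> ?A - S"
      then show "Poly_Mapping.single (add_nodes l (add_nodes l L S) {x})
          (qfact r * qv powi ?v S * qv powi (?x x - 2 * int (above e l s x S)))
        = Poly_Mapping.single (add_nodes l L (insert x S))
          (qfact r * qv powi (?v S + ?x x - 2 * int (above e l s x S)))"
        by (simp add: add_nodes_add_nodes[OF L S'] mult.assoc power_int_add[symmetric] add_diff_eq)
    qed
  qed
  have "(f_op e l s j ^^ Suc r) (Poly_Mapping.single L 1)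
      = (\<Sum>S\<in>node_choices e l s j L r. \<Sum>x\<in>?A - S. Poly_Mapping.single (add_nodes l L (insert x S))
          (qfact r * qv powi (?v S + ?x x - 2 * int (above e l s x S))))"
    by (simp add: Suc f_op_sum step)
  also have "\<dots> = (\<Sum>(S, x)\<in>(SIGMA S:node_choices e l s j L r. ?A - S).
      Poly_Mapping.single (add_nodes l L (insert x S))
          (qfact r * qv powi (?v S + ?x x - 2 * int (above e l s x S))))"
    using A by (intro sum.Sigma) auto
  also have "\<dots> = (\<Sum>(T, x)\<in>(SIGMA T:node_choices e l s j L (Suc r). T).
      Poly_Mapping.single (add_nodes l L T)
          (qfact r * qv powi (?v T + int r - 2 * int (above e l s x T))))"
  proof (rule sum.reindex_bij_witness[of _ "\<lambda>(T, x). (T - {x}, x)" "\<lambda>(S, x). (insert x S, x)"])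
    fix p assume "p \<in> (SIGMA S:node_choices e l s j L r. ?A - S)"
    then obtain S x where p: "p = (S, x)" and S: "S \<subseteq> ?A" "card S = r" and x: "x \<in> ?A" "x \<notin> S"
      by auto
    have fin: "finite S" using A S finite_subset by blast
    show "(case case p of (S, x) \<Rightarrow> (insert x S, x) of (T, x) \<Rightarrow> (T - {x}, x)) = p"
      using p x by simp
    show "(case p of (S, x) \<Rightarrow> (insert x S, x)) \<in> (SIGMA T:node_choices e l s j L (Suc r). T)"
      using p x S fin by simp
    \<comment> \<open>The triangular correction in \<open>choice_exp\<close> grows by exactly r when
      the set grows from r to r + 1 elements.\<close>
    have "?v (insert x S) + int r = ?v S + ?x x"
      unfolding choice_exp_def using x S fin by simp
    then show "(case case p of (S, x) \<Rightarrow> (insert x S, x) of (T, x) \<Rightarrow>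
        Poly_Mapping.single (add_nodes l L T)
          (qfact r * qv powi (?v T + int r - 2 * int (above e l s x T))))
      = (case p of (S, x) \<Rightarrow> Poly_Mapping.single (add_nodes l L (insert x S))
          (qfact r * qv powi (?v S + ?x x - 2 * int (above e l s x S))))"
      using p by (simp add: above_insert_self)
  next
    fix p assume "p \<in> (SIGMA T:node_choices e l s j L (Suc r). T)"
    then obtain T x where p: "p = (T, x)" and T: "T \<subseteq> ?A" "card T = Suc r" and x: "x \<in> T"
      by auto
    have fin: "finite T" using A T finite_subset by blast
    show "(case case p of (T, x) \<Rightarrow> (T - {x}, x) of (S, x) \<Rightarrow> (insert x S, x)) = p"
      using p x by auto
    show "(case p of (T, x) \<Rightarrow> (T - {x}, x)) \<in> (SIGMA S:node_choices e l s j L r. ?A - S)"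
      using p x T fin by auto
  qed
  also have "\<dots> = (\<Sum>T\<in>node_choices e l s j L (Suc r). \<Sum>x\<in>T.
      Poly_Mapping.single (add_nodes l L T)
          (qfact r * qv powi (?v T + int r - 2 * int (above e l s x T))))"
    using A by (intro sum.Sigma[symmetric]) (auto intro: finite_subset)
  also have "\<dots> = (\<Sum>T\<in>node_choices e l s j L (Suc r).
      Poly_Mapping.single (add_nodes l L T) (qfact (Suc r) * qv powi ?v T))"
  proof (rule sum.cong[OF refl])
    fix T assume "T \<in> node_choices e l s j L (Suc r)"
    then have T: "T \<subseteq> ?A" "card T = Suc r" by auto
    have "inj_on (pos e l s) T" "finite T"
      using inj_on_subset[OF addables_pos_inj[OF L] T(1)] e finite_subset[OF T(1) A] by auto
    then have "(\<Sum>x\<in>T. qv powi (- 2 * int (above e l s x T))) = (\<Sum>k<Suc r. qv powi (- 2 * int k))"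
      using sum_above[of T e l s "\<lambda>k. qv powi (- 2 * int k)"] T(2) by simp
    moreover have "qv powi (p + q - 2 * k) = qv powi p * (qv powi q * qv powi (- 2 * k))"
      for p q k :: int
    proof -
      have "p + q - 2 * k = p + (q + (- 2 * k))" by simp
      then show ?thesis by (simp only: power_int_add[OF disjI1[OF qv_nonzero]])
    qed
    ultimately have "(\<Sum>x\<in>T. qfact r * qv powi (?v T + int r - 2 * int (above e l s x T)))
        = qfact r * (qv powi ?v T * qint (Suc r))"
      unfolding qint_Suc_eq_sum by (simp flip: sum_distrib_left)
    then show "(\<Sum>x\<in>T. Poly_Mapping.single (add_nodes l L T)
          (qfact r * qv powi (?v T + int r - 2 * int (above e l s x T))))
        = Poly_Mapping.single (add_nodes l L T) (qfact (Suc r) * qv powi ?v T)"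
      unfolding single_sum qfact_Suc by (simp add: mult_ac)
  qed
  finally show ?case .
qed

lemma f_divpow_single:
  assumes L: "lpart l L" and e: "e > 1"
  shows "f_divpow e l s j r (Poly_Mapping.single L 1) = (\<Sum>S\<in>node_choices e l s j L r.
    Poly_Mapping.single (add_nodes l L S) (qv powi choice_exp e l s j L S))"
  unfolding f_divpow_def f_op_power_single[OF L e] fock_scale_sum fock_scale_single
  by (simp add: qfact_nonzero)

text \<open>Above a node of \<open>S\<close> there are no j-nodes, addable or removable, except
  members of \<open>S\<close>. The excesses are therefore 0, 1, ..., \<open>card S\<close> - 1 in
  some order and cancel the correction.\<close>

lemma choice_exp_top:
  assumes L: "lpart l L" and e: "e > 1" and top: "top_addables e l s j L S"
  shows "choice_exp e l s j L S = 0"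
proof -
  have S: "S \<subseteq> addables e l s j L" using top unfolding top_addables_def by blast
  have "excess e l s j L x = int (above e l s x S)" if x: "x \<in> S" for x
  proof -
    have "\<not> pos e l s x < pos e l s y"
      if "y \<in> (addables e l s j L - S) \<union> removables e l s j L" for y
      using top x that unfolding top_addables_def by (meson less_asym)
    then have "{y \<in> removables e l s j L. pos e l s x < pos e l s y} = {}"
      "{y \<in> addables e l s j L. pos e l s x < pos e l s y} = {y \<in> S. pos e l s x < pos e l s y}"
      using S by blast+
    then show ?thesis unfolding excess_def above_def by (simp only: card.empty of_nat_0 diff_zero)
  qed
  then have "(\<Sum>x\<in>S. excess e l s j L x) = (\<Sum>x\<in>S. int (above e l s x S))" by simp
  also have "\<dots> = (\<Sum>k<card S. int k)"
    using sum_above[of S e l s int] inj_on_subset[OF addables_pos_inj[OF L] S] e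
      finite_subset[OF S finite_addables[OF L]] by simp
  finally show ?thesis unfolding choice_exp_def by simp
qed

section \<open>The lexicographic order\<close>

text \<open>The order in which \<open>lex_less\<close> reads the rows. Columns are ignored, since a
  row has at most one addable node.\<close>

definition row_less :: "node \<Rightarrow> node \<Rightarrow> bool" where
  "row_less x y \<longleftrightarrow> component x < component y \<or> component x = component y \<and> fst x < fst y"

lemma addable_row_iff:
  assumes L: "lpart l L"
  shows "addable l L (a, b, c) \<longleftrightarrow>
    c \<in> {1..l} \<and> 1 \<le> a \<and> b = Suc (L c a) \<and> (1 < a \<longrightarrow> b \<le> L c (a - 1))"
  unfolding addable_iff[OF L] mem_young[OF L] by auto

section \<open>Order of the nodes against order of the rows\<close>

lemma charge_gap:
  fixes s :: "nat \<Rightarrow> int" and g :: int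
  assumes gap: "\<forall>c\<in>{2..l}. s (c - 1) - s c \<ge> g" and "g \<ge> 0" and "1 \<le> c" "c < c'" "c' \<le> l"
  shows "s c - s c' \<ge> g"
proof -
  have "Suc c \<le> c'" using assms by simp
  then show ?thesis using assms(5)
  proof (induction rule: dec_induct)
    case base
    then show ?case using gap[rule_format, of "Suc c"] assms(3) by simp
  next
    case (step d)
    then show ?case using gap[rule_format, of "Suc d"] assms(2,3) by simp
  qed
qed

text \<open>A column and a row in different components share no node. This limits how far contents
  in two components can drift towards each other.\<close>

lemma leg_plus_arm_le_rank:
  assumes L: "lpart l L" and "c \<noteq> c'" "c' \<in> {1..l}" "1 \<le> a'"
    and col: "k = 0 \<or> (k, 1, c) \<in> young l L"
  shows "k + L c' a' \<le> rank l L"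
proof -
  let ?C = "(\<lambda>i. (i, 1::nat, c)) ` {1..k}" and ?R = "(\<lambda>i. (1::nat, i, c')) ` {1..L c' a'}"
  have "?C \<subseteq> young l L"
  proof (rule image_subsetI)
    fix i assume "i \<in> {1..k}"
    then show "(i, 1, c) \<in> young l L"
      using col diagram_closed[OF diagram_young[OF L], of k 1 c i 1] by auto
  qed
  moreover have "?R \<subseteq> young l L"
  proof (rule image_subsetI)
    fix i assume "i \<in> {1..L c' a'}"
    then show "(1, i, c') \<in> young l L"
      using assms(3,4) lpart_antimono[OF L, of 1 a' c'] by (auto simp: mem_young[OF L])
  qed
  ultimately have "card (?C \<union> ?R) \<le> rank l L"
    unfolding rank_eq_card[OF L] by (intro card_mono finite_young) simp
  moreover have "card (?C \<union> ?R) = card ?C + card ?R"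
    using assms(2) by (intro card_Un_disjoint) auto
  ultimately show ?thesis by (simp add: card_image inj_on_def)
qed

text \<open>The size of the gaps in the charge makes the order on the nodes compatible with the order
  of the rows that underlies the lexicographic order.\<close>

lemma row_less_imp_pos_less:
  fixes e :: int
  assumes L: "lpart l L" and e: "e > 1"
    and gap: "\<forall>c\<in>{2..l}. s (c - 1) - s c \<ge> int n - 1 + e" and n: "rank l L \<le> n"
    and x: "x \<in> addables e l s j L \<union> removables e l s j L" and y: "y \<in> addables e l s j L"
    and rl: "row_less x y"
  shows "pos e l s y < pos e l s x"
proof -
  obtain a b c where xe: "x = (a, b, c)" by (cases x)
  obtain a' b' c' where ye: "y = (a', b', c')" by (cases y)
  have xar: "addable l L (a, b, c) \<or> removable l L (a, b, c)" and xr: "residue e s x = j"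
    using x xe unfolding addables_def removables_def by auto
  have ya: "addable l L (a', b', c')" and yr: "residue e s y = j"
    using y ye unfolding addables_def by auto
  have yrow: "c' \<in> {1..l}" "1 \<le> a'" "b' = Suc (L c' a')" using ya addable_row_iff[OF L] by auto
  have xc: "c \<in> {1..l}" "1 \<le> a" "1 \<le> b"
    and b: "b = Suc (L c a) \<or> b = L c a \<and> L c (Suc a) < b"
    and col: "a - 1 = 0 \<or> (a - 1, 1, c) \<in> young l L"
  proof -
    have "a - 1 = 0 \<or> (a - 1, 1, c) \<in> young l L"
      if "c \<in> {1..l}" "1 < a \<longrightarrow> 1 \<le> L c (a - 1)"
      using that by (cases "1 < a") (auto simp: mem_young[OF L])
    moreover have "c \<in> {1..l} \<and> 1 \<le> a \<and> 1 \<le> b \<and>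
      (b = Suc (L c a) \<or> b = L c a \<and> L c (Suc a) < b) \<and> (1 < a \<longrightarrow> 1 \<le> L c (a - 1))"
      using xar
    proof
      assume "addable l L (a, b, c)"
      then show ?thesis unfolding addable_row_iff[OF L] by auto
    next
      assume r: "removable l L (a, b, c)"
      then have "c \<in> {1..l}" "1 \<le> a" "1 \<le> b" "b \<le> L c a"
        unfolding removable_iff[OF L] mem_young[OF L] by auto
      moreover have "1 < a \<longrightarrow> L c a \<le> L c (a - 1)" using lpart_antimono[OF L, of "a - 1" a c] by simp
      ultimately show ?thesis using removable_row[OF L r] by auto
    qed
    ultimately show "c \<in> {1..l}" "1 \<le> a" "1 \<le> b" "b = Suc (L c a) \<or> b = L c a \<and> L c (Suc a) < b"
      "a - 1 = 0 \<or> (a - 1, 1, c) \<in> young l L" by blast+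
  qed
  have "cont s y < cont s x"
  proof (cases "c = c'")
    case True
    then have "a < a'" using rl xe ye unfolding row_less_def by simp
    then have "L c a' \<le> L c (Suc a)" "L c a' \<le> L c a"
      using xc(2) lpart_antimono[OF L, of "Suc a" a' c] lpart_antimono[OF L, of a a' c] by simp_all
    moreover have "b' = Suc (L c a')" using yrow(3) True by simp
    \<comment> \<open>For addable \<open>x\<close> the rows are non-increasing; for removable
      \<open>x\<close> the row below is strictly shorter, which absorbs the extra 1 in b'.\<close>
    ultimately have "b' \<le> b" using b by linarith
    then show ?thesis using \<open>a < a'\<close> xe ye True by simp
  next
    case False
    then have "c < c'" using rl xe ye unfolding row_less_def by simp
    then have g: "s c - s c' \<ge> int n - 1 + e" using charge_gap[OF gap, of c c'] e xc yrow by simp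
    \<comment> \<open>With b and a' at least 1, this bound and the charge gap n - 1 + e leave a
      content difference of at least e - 1, which is positive.\<close>
    have "(a - 1) + L c' a' \<le> n"
      using leg_plus_arm_le_rank[OF L False yrow(1,2) col] n by simp
    then have "int a - 1 + int (L c' a') \<le> int n" using xc(2) by linarith
    then have "cont s y < cont s x"
      using g e yrow(2,3) xc(3) unfolding xe ye cont.simps by linarith
    then show ?thesis .
  qed
  then have "node_less s y x" unfolding node_less_def by simp
  then show ?thesis
    using node_less_iff_pos[of e s y x l] e xr yr xc(1) yrow(1) xe ye by simp
qed

section \<open>Lexicographic comparison of two additions\<close>

text \<open>\<open>P\<close> marks an initial segment of rows. The highest node of the symmetric
  difference within it also lies in the earliest differing row, and it must belong to
  \<open>S\<close> because \<open>T\<close> is no larger than \<open>S\<close>.\<close>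

lemma top_addables_row_difference:
  fixes e :: int
  assumes L: "lpart l L" and e: "e > 1"
    and gap: "\<forall>c\<in>{2..l}. s (c - 1) - s c \<ge> int n - 1 + e" and n: "rank l L \<le> n"
    and top: "top_addables e l s j L S"
    and T: "T \<subseteq> addables e l s j L" "card T \<le> card S" "\<And>x. x \<in> T \<Longrightarrow> P x"
    and P: "\<And>x y. row_less x y \<Longrightarrow> P y \<Longrightarrow> P x"
    and neq: "T \<noteq> {x \<in> S. P x}"
  obtains x where "x \<in> S" "P x" "x \<notin> T" "\<And>y. P y \<Longrightarrow> row_less y x \<Longrightarrow> y \<in> S \<longleftrightarrow> y \<in> T"
proof -
  let ?A = "addables e l s j L" and ?S = "{x \<in> S. P x}"
  have S: "S \<subseteq> ?A" using top unfolding top_addables_def by blast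
  have fin: "finite S" "finite T" using S T(1) finite_subset[OF _ finite_addables[OF L]] by blast+
  define D where "D = (?S - T) \<union> (T - ?S)"
  have finD: "finite (pos e l s ` D)" using fin unfolding D_def by simp
  have "D \<noteq> {}" using neq T(3) unfolding D_def by blast
  then have "Max (pos e l s ` D) \<in> pos e l s ` D" using finD by simp
  then obtain x where x: "x \<in> D" and xmax: "Max (pos e l s ` D) = pos e l s x" by blast
  have max: "pos e l s y \<le> pos e l s x" if "y \<in> D" for y
    unfolding xmax[symmetric] using finD that by simp
  have "x \<notin> T - ?S"
  proof
    assume xT: "x \<in> T - ?S"
    then have xA: "x \<in> ?A - S" using T by blast
    \<comment> \<open>All of \<open>S\<close> lies above the unchosen node \<open>x\<close>, hence
      in earlier rows and inside the segment; by maximality of \<open>x\<close> it then lies in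
      \<open>T\<close>, which would make \<open>T\<close> larger than \<open>S\<close>.\<close>
    have "y \<in> T - {x}" if y: "y \<in> S" for y
    proof -
      have less: "pos e l s x < pos e l s y" using top y xA unfolding top_addables_def by blast
      obtain a b c where xe: "x = (a, b, c)" by (cases x)
      obtain a' b' c' where ye: "y = (a', b', c')" by (cases y)
      have "\<not> row_less x y"
        using less row_less_imp_pos_less[OF L e gap n, of x j y] xA y S by force
      moreover have "\<not> (c = c' \<and> a = a')"
      proof
        assume "c = c' \<and> a = a'"
        moreover have "addable l L (a, b, c)" "addable l L (a', b', c')"
          using xA y S xe ye unfolding addables_def by blast+
        ultimately have "x = y" using addable_row[OF L] xe ye by metis
        then show False using less by simp
      qed
      ultimately have "row_less y x" unfolding row_less_def xe ye by auto
      then have "P y" using P xT T(3) by blast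
      moreover have "y \<notin> D" using max less by fastforce
      ultimately show ?thesis using y less unfolding D_def by blast
    qed
    then have "S \<subseteq> T - {x}" by blast
    then have "card S \<le> card (T - {x})" using fin by (intro card_mono) auto
    also have "\<dots> < card T" using xT fin by (intro psubset_card_mono) auto
    finally show False using T(2) by simp
  qed
  then have xS: "x \<in> S" "P x" "x \<notin> T" using x unfolding D_def by blast+
  have "y \<in> S \<longleftrightarrow> y \<in> T" if "P y" "row_less y x" for y
  proof (rule ccontr)
    assume "\<not> ?thesis"
    then have yD: "y \<in> D" using that T(3) unfolding D_def by blast
    then have "y \<in> ?A" using S T(1) unfolding D_def by blast
    then have "pos e l s x < pos e l s y"
      using row_less_imp_pos_less[OF L e gap n, of y j x] that xS S by blast
    then show False using max[OF yD] by simp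
  qed
  then show thesis using that xS by blast
qed

lemma lex_lessI:
  assumes "c \<in> {1..l}" "1 \<le> a"
    and "\<And>c' a'. c' < c \<or> c' = c \<and> a' < a \<Longrightarrow> L c' a' = M c' a'" and "L c a < M c a"
  shows "lex_less l L M"
  unfolding lex_less_def
  using assms by (intro bexI[of _ c] exI[of _ a] conjI ballI ext) auto

text \<open>If \<open>N\<close> precedes \<open>M\<close> and first differs from it in row \<open>k\<close> of component \<open>t\<close>, the sums can only tie
  there if \<open>T\<close> fills the gap with the \<open>j\<close>-node at the end of that row of \<open>M\<close>.  Then \<open>S\<close> still has
  nodes to place further down, so that \<open>j\<close>-node of \<open>M\<close> is not removable and row \<open>k + 1\<close> of \<open>M\<close> is equally
  long; there \<open>T\<close> cannot catch up, for lack of the right residue.\<close>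

lemma lex_less_add_nodes:
  fixes e :: int
  assumes M: "lpart l M" and N: "lpart l N" and e: "e > 1"
    and gap: "\<forall>c\<in>{2..l}. s (c - 1) - s c \<ge> int n - 1 + e" and n: "rank l M \<le> n"
    and top: "top_addables e l s j M S"
    and T: "T \<subseteq> addables e l s j N" "card T = card S"
    and le: "N = M \<and> T \<noteq> S \<or> lex_less l N M"
  shows "lex_less l (add_nodes l N T) (add_nodes l M S)"
proof -
  let ?A = "addables e l s j M"
  have S: "S \<subseteq> ?A" using top unfolding top_addables_def by blast
  note S' = subset_trans[OF S addables_subset] and T' = subset_trans[OF T(1) addables_subset]
  have fin: "finite S" "finite T"
    using finite_subset[OF S finite_addables[OF M]] finite_subset[OF T(1) finite_addables[OF N]] .
  note rowM = add_nodes_row[OF M S'] and rowN = add_nodes_row[OF N T']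
  \<comment> \<open>Both the case N = M and the case of choices differing before the first differing
    row end here: the earliest difference is a node of \<open>S\<close> that \<open>T\<close>
    misses, in a row where N and M agree.\<close>
  have first_difference: "lex_less l (add_nodes l N T) (add_nodes l M S)"
    if x: "x \<in> S" "x \<notin> T" "P x"
      and agree: "\<And>y. P y \<Longrightarrow> row_less y x \<Longrightarrow> y \<in> S \<longleftrightarrow> y \<in> T"
      and P: "\<And>a b c. P (a, b, c) \<Longrightarrow> N c a = M c a" "\<And>x y. row_less x y \<Longrightarrow> P y \<Longrightarrow> P x"
    for x P
  proof -
    obtain a b c where xe: "x = (a, b, c)" by (cases x)
    have "addable l M (a, b, c)" using x(1) S' xe by blast
    then have xa: "c \<in> {1..l}" "1 \<le> a" "b = Suc (M c a)" using addable_row_iff[OF M] by auto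
    show ?thesis
    proof (rule lex_lessI[OF xa(1,2)])
      fix c' a' assume "c' < c \<or> c' = c \<and> a' < a"
      then have rl: "row_less (a', b', c') x" for b' unfolding row_less_def xe by auto
      then have "P (a', b', c')" for b' using P(2) x(3) by blast
      then show "add_nodes l N T c' a' = add_nodes l M S c' a'"
        unfolding rowM rowN using P(1) agree rl by simp
    next
      show "add_nodes l N T c a < add_nodes l M S c a"
        using x P(1)[of a b c] xa(3) unfolding rowM rowN xe by simp
    qed
  qed
  show ?thesis
  proof (cases "N = M")
    case True
    have "\<not> lex_less l M M" unfolding lex_less_def by auto
    then have "T \<noteq> {x \<in> S. True}" using True le by auto
    from top_addables_row_difference[OF M e gap n top _ _ _ _ this]
    obtain x where "x \<in> S" "x \<notin> T" "\<And>y. row_less y x \<Longrightarrow> y \<in> S \<longleftrightarrow> y \<in> T"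
      using T True by auto
    then show ?thesis using first_difference[of x "\<lambda>_. True"] True by simp
  next
    case False
    then have "lex_less l N M" using le by blast
    then obtain t k where t: "t \<in> {1..l}" and k: "1 \<le> k"
      and eqc: "\<forall>t'\<in>{1..<t}. N t' = M t'" and eqr: "\<forall>m\<in>{1..<k}. N t m = M t m"
      and lt: "N t k < M t k"
      unfolding lex_less_def by blast
    define P :: "node \<Rightarrow> bool" where "P = (\<lambda>(a, b, c). c < t \<or> c = t \<and> a < k)"
    \<comment> \<open>\<open>lex_less\<close> speaks only of indices from 1 on; at index 0 both
      sides are padded with zeros.\<close>
    have eq: "N c a = M c a" if "c < t \<or> c = t \<and> a < k" for c a
      using that eqc eqr lpart_row_0[OF N] lpart_row_0[OF M]
        lpart_zero_component[OF N] lpart_zero_component[OF M]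
      by (cases "c = 0"; cases "a = 0"; auto)
    have P_eq: "P (a, b, c) \<Longrightarrow> N c a = M c a" for a b c using eq unfolding P_def by simp
    have P_down: "row_less x y \<Longrightarrow> P y \<Longrightarrow> P x" for x y
      unfolding P_def row_less_def by (cases x; cases y) auto
    let ?T = "{x \<in> T. P x}"
    \<comment> \<open>Addability in a row depends only on that row and the preceding one, where N
      and M agree.\<close>
    have "?T \<subseteq> ?A"
    proof
      fix x assume x: "x \<in> ?T"
      obtain a b c where xe: "x = (a, b, c)" by (cases x)
      have "addable l N (a, b, c)" "residue e s x = j" "P (a, b, c)"
        using x T(1) xe unfolding addables_def by auto
      moreover from this have "N c a = M c a" "N c (a - 1) = M c (a - 1)"
        using eq unfolding P_def by auto
      ultimately show "x \<in> ?A"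
        unfolding addables_def xe by (auto simp: addable_row_iff[OF N] addable_row_iff[OF M])
    qed
    have cardT: "card ?T \<le> card S" using T(2) card_mono[OF fin(2), of ?T] by simp
    show ?thesis
    proof (cases "?T = {x \<in> S. P x}")
      case False
      obtain x where x: "x \<in> S" "P x" "x \<notin> ?T"
        and agree: "\<And>y. P y \<Longrightarrow> row_less y x \<Longrightarrow> y \<in> S \<longleftrightarrow> y \<in> ?T"
      proof (rule top_addables_row_difference[OF M e gap n top \<open>?T \<subseteq> ?A\<close> cardT, where P = P])
        show "?T \<noteq> {x \<in> S. P x}" by (rule False)
        show "row_less x y \<Longrightarrow> P y \<Longrightarrow> P x" for x y by (rule P_down)
      qed (use that in blast)+
      show ?thesis
      proof (rule first_difference[of x P])
        show "x \<in> S" "P x" by (rule x)+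
        show "x \<notin> T" using x by simp
        show "N c a = M c a" if "P (a, b, c)" for a b c by (rule P_eq[OF that])
        show "P y" if "row_less y z" "P z" for y z by (rule P_down[OF that])
        show "y \<in> S \<longleftrightarrow> y \<in> T" if "P y" "row_less y x" for y using agree[OF that] that by simp
      qed
    next
      case True
      have before: "add_nodes l N T c a = add_nodes l M S c a" if "c < t \<or> c = t \<and> a < k" for c a
      proof -
        have P: "P (a, b, c)" for b using that unfolding P_def by simp
        then have "(a, b, c) \<in> T \<longleftrightarrow> (a, b, c) \<in> S" for b using True by blast
        then show ?thesis unfolding rowM rowN P_eq[OF P] by simp
      qed
      \<comment> \<open>Row k of N is shorter by at least 1, and \<open>T\<close> adds at most one
        node to it.\<close>
      have le: "add_nodes l N T t k \<le> add_nodes l M S t k" using lt unfolding rowM rowN by simp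
      show ?thesis
      proof (cases "add_nodes l N T t k = add_nodes l M S t k")
        case False
        then show ?thesis using before le t k by (intro lex_lessI[of t l k]) auto
      next
        case eqk: True
        then have kT: "(k, Suc (N t k), t) \<in> T" and Nk: "Suc (N t k) = M t k"
          using lt unfolding rowM rowN by (auto split: if_splits)
        have resk: "residue e s (k, M t k, t) = j" using kT T(1) Nk unfolding addables_def by auto
        have "(k, Suc (N t k), t) \<notin> ?T" unfolding P_def by simp
        \<comment> \<open>\<open>T\<close> spends a node on row k, so \<open>S\<close>, of the same
          size and equal to \<open>T\<close> on earlier rows, has a node outside these rows.\<close>
        then have "card ?T < card T" using kT fin(2) by (intro psubset_card_mono) auto
        then have "S \<noteq> {x \<in> S. P x}" using True T(2) by auto
        then obtain y where y: "y \<in> S" "\<not> P y" by blast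
        obtain a b c where ye: "y = (a, b, c)" by (cases y)
        have yad: "addable l M (a, b, c)" "residue e s (a, b, c) = j"
          using y(1) S ye unfolding addables_def by auto
        have "\<not> (c = t \<and> a = k)"
          using yad addable_row[OF M yad(1)] resk residue_neighbour(2)[OF e, of s k "M t k" t] by auto
        then have rl: "row_less (k, M t k, t) y"
          using y(2) unfolding P_def row_less_def ye by auto
        have "\<not> removable l M (k, M t k, t)"
        proof
          assume "removable l M (k, M t k, t)"
          then have r: "(k, M t k, t) \<in> removables e l s j M" using resk unfolding removables_def by simp
          then have "pos e l s (k, M t k, t) < pos e l s y"
            using top y(1) unfolding top_addables_def by blast
          moreover have "pos e l s y < pos e l s (k, M t k, t)"
            using row_less_imp_pos_less[OF M e gap n _ _ rl] r y(1) S by blast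
          ultimately show False by simp
        qed
        then have "M t k \<le> M t (Suc k)"
          using lt t k unfolding removable_iff[OF M] mem_young[OF M] by auto
        then have Mk: "M t (Suc k) = M t k" using lpart_antimono[OF M k, of "Suc k" t] by simp
        \<comment> \<open>This place is directly below a j-node. If row k + 1 of N is as long as row
          k, nothing can be added to it; if it is shorter, one node brings it at most to N t k.
          Either way it stays below M.\<close>
        have "(Suc k, Suc (N t k), t) \<notin> T"
          using resk Nk T(1) residue_neighbour(1)[OF e, of s k "M t k" t] unfolding addables_def by auto
        moreover have "N t (Suc k) \<le> N t k" using lpart_antimono[OF N k, of "Suc k" t] by simp
        ultimately have "add_nodes l N T t (Suc k) < M t (Suc k)"
          unfolding rowN using Nk Mk by (cases "N t (Suc k) = N t k") auto
        then have "add_nodes l N T t (Suc k) < add_nodes l M S t (Suc k)" unfolding rowM by simp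
        then show ?thesis
          using before eqk t by (intro lex_lessI[of t l "Suc k"]) (auto simp: less_Suc_eq)
      qed
    qed
  qed
qed

section \<open>Unitriangularity\<close>

lemma laurent_0: "laurent 0" and laurent_1: "laurent 1"
  unfolding laurent_def by (metis div_0 to_fract_0, metis div_by_1 power_0 to_fract_1)

lemma laurent_mult:
  assumes "laurent x" "laurent y"
  shows "laurent (x * y)"
proof -
  obtain p k q k' where "x = to_fract p / qv ^ k" "y = to_fract q / qv ^ k'"
    using assms unfolding laurent_def by blast
  then have "x * y = to_fract (p * q) / qv ^ (k + k')" by (simp add: power_add)
  then show ?thesis unfolding laurent_def by blast
qed

lemma laurent_add:
  assumes "laurent x" "laurent y"
  shows "laurent (x + y)"
proof -
  obtain p k q k' where "x = to_fract p / qv ^ k" "y = to_fract q / qv ^ k'"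
    using assms unfolding laurent_def by blast
  then have "x + y = (to_fract p * qv ^ k' + to_fract q * qv ^ k) / qv ^ (k + k')"
    by (simp add: power_add add_divide_distrib)
  also have "\<dots> = to_fract (p * [:0, 1:] ^ k' + q * [:0, 1:] ^ k) / qv ^ (k + k')"
    unfolding to_fract_add to_fract_mult qv_power[symmetric] ..
  finally show ?thesis unfolding laurent_def by blast
qed

lemma laurent_sum: "(\<And>i. i \<in> I \<Longrightarrow> laurent (g i)) \<Longrightarrow> laurent (\<Sum>i\<in>I. g i)"
  by (induction I rule: infinite_finite_induct) (simp_all add: laurent_0 laurent_add)

lemma laurent_powi: "laurent (qv powi k)"
proof (cases "k \<ge> 0")
  case True
  then have "qv powi k = to_fract ([:0, 1:] ^ nat k) / qv ^ 0"
    by (simp add: power_int_def flip: qv_power)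
  then show ?thesis unfolding laurent_def by blast
next
  case False
  then have "qv powi k = to_fract 1 / qv ^ nat (- k)"
    by (simp add: power_int_def field_simps)
  then show ?thesis unfolding laurent_def by blast
qed

text \<open>Shape and rank are recorded along with the order, so that the support stays within the
  finite index set of the final sum.\<close>

definition unitriangular :: "nat \<Rightarrow> fock \<Rightarrow> mpart \<Rightarrow> bool" where
  "unitriangular l u L \<longleftrightarrow> Poly_Mapping.lookup u L = 1 \<and>
     (\<forall>M. laurent (Poly_Mapping.lookup u M)) \<and>
     (\<forall>M. Poly_Mapping.lookup u M \<noteq> 0 \<longrightarrow>
        M = L \<or> lpart l M \<and> rank l M = rank l L \<and> lex_less l M L)"

lemma unitriangular_expand:
  assumes "unitriangular l u L"
  shows "u = Poly_Mapping.single L 1 +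
    (\<Sum>M | lpart l M \<and> rank l M = rank l L \<and> lex_less l M L.
       Poly_Mapping.single M (Poly_Mapping.lookup u M))"
proof (rule poly_mapping_eqI)
  fix K
  let ?X = "{M. lpart l M \<and> rank l M = rank l L \<and> lex_less l M L}"
  have "finite ?X" by (rule finite_subset[OF _ finite_lpart_rank[of l "rank l L"]]) blast
  then have "(\<Sum>M\<in>?X. Poly_Mapping.lookup (Poly_Mapping.single M (Poly_Mapping.lookup u M)) K)
      = (if K \<in> ?X then Poly_Mapping.lookup u K else 0)"
    by (simp add: lookup_single when_def)
  moreover have "L \<notin> ?X" unfolding lex_less_def by auto
  moreover have "Poly_Mapping.lookup u L = 1" "Poly_Mapping.lookup u K \<noteq> 0 \<Longrightarrow> K = L \<or> K \<in> ?X"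
    using assms unfolding unitriangular_def by blast+
  ultimately show "Poly_Mapping.lookup u K = Poly_Mapping.lookup (Poly_Mapping.single L 1 +
      (\<Sum>M\<in>?X. Poly_Mapping.single M (Poly_Mapping.lookup u M))) K"
    unfolding lookup_add lookup_sum by (cases "K = L") (auto simp: lookup_single when_def)
qed

lemma lookup_f_divpow:
  "Poly_Mapping.lookup (f_divpow e l s j r u) K = (\<Sum>N\<in>Poly_Mapping.keys u.
     Poly_Mapping.lookup u N *
     Poly_Mapping.lookup (f_divpow e l s j r (Poly_Mapping.single N 1)) K)"
  by (subst f_divpow_expand) (simp add: lookup_sum)

lemma lookup_f_divpow_single:
  assumes "lpart l N" "e > 1"
  shows "Poly_Mapping.lookup (f_divpow e l s j r (Poly_Mapping.single N 1)) K =
    (\<Sum>T\<in>node_choices e l s j N r. if add_nodes l N T = K then qv powi choice_exp e l s j N T else 0)"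
  unfolding f_divpow_single[OF assms] lookup_sum by (simp add: lookup_single when_def)

text \<open>Among all pairs of a term N of \<open>u\<close> and a choice T in N, the pair (M, S)
  alone gives the lexicographically largest result. The leading coefficient thus has a single
  contribution, v to the power 0.\<close>

lemma unitriangular_f_divpow:
  fixes e :: int
  assumes M: "lpart l M" and e: "e > 1"
    and gap: "\<forall>c\<in>{2..l}. s (c - 1) - s c \<ge> int n - 1 + e" and n: "rank l M \<le> n"
    and top: "top_addables e l s j M S" and u: "unitriangular l u M"
  shows "unitriangular l (f_divpow e l s j (card S) u) (add_nodes l M S)"
proof -
  let ?f = "\<lambda>N. f_divpow e l s j (card S) (Poly_Mapping.single N 1)"
  have S: "S \<subseteq> addables e l s j M" using top unfolding top_addables_def by blast
  note S' = subset_trans[OF S addables_subset]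
  have keys: "N = M \<or> lpart l N \<and> rank l N = rank l M \<and> lex_less l N M"
    if "N \<in> Poly_Mapping.keys u" for N
    using u that unfolding unitriangular_def by (metis in_keys_iff)
  then have keys_lpart: "lpart l N" "rank l N = rank l M" if "N \<in> Poly_Mapping.keys u" for N
    using that M by blast+
  have lex: "N = M \<and> T = S \<or> lex_less l (add_nodes l N T) (add_nodes l M S)"
    if N: "N \<in> Poly_Mapping.keys u" and T: "T \<in> node_choices e l s j N (card S)" for N T
  proof (cases "N = M \<and> T = S")
    case False
    then have "N = M \<and> T \<noteq> S \<or> lex_less l N M" using keys[OF N] by blast
    then show ?thesis
      using lex_less_add_nodes[OF M keys_lpart(1)[OF N] e gap n top, of T] T by blast
  qed simp
  have irrefl: "\<not> lex_less l K K" for K unfolding lex_less_def by auto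
  show ?thesis
    unfolding unitriangular_def
  proof (intro conjI allI impI)
    fix K
    have "laurent (Poly_Mapping.lookup u N * Poly_Mapping.lookup (?f N) K)"
      if "N \<in> Poly_Mapping.keys u" for N
      unfolding lookup_f_divpow_single[OF keys_lpart(1)[OF that] e]
      using u by (auto simp: unitriangular_def laurent_0 laurent_powi intro!: laurent_mult laurent_sum)
    then show "laurent (Poly_Mapping.lookup (f_divpow e l s j (card S) u) K)"
      unfolding lookup_f_divpow[of e l s j "card S" u] by (rule laurent_sum)
  next
    fix K assume "Poly_Mapping.lookup (f_divpow e l s j (card S) u) K \<noteq> 0"
    then obtain N where N: "N \<in> Poly_Mapping.keys u" and nz: "Poly_Mapping.lookup (?f N) K \<noteq> 0"
      unfolding lookup_f_divpow[of e l s j "card S" u]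
      by (elim sum.not_neutral_contains_not_neutral) simp
    then obtain T where T: "T \<in> node_choices e l s j N (card S)" and K: "add_nodes l N T = K"
      unfolding lookup_f_divpow_single[OF keys_lpart(1)[OF N] e]
      by (elim sum.not_neutral_contains_not_neutral) (simp split: if_splits)
    have T': "T \<subseteq> {\<gamma>. addable l N \<gamma>}" "card T = card S" using T addables_subset by blast+
    have "lpart l K" "rank l K = rank l (add_nodes l M S)"
      using lpart_add_nodes[OF keys_lpart(1)[OF N] T'(1)] rank_add_nodes[OF keys_lpart(1)[OF N] T'(1)]
        rank_add_nodes[OF M S'] keys_lpart(2)[OF N] T'(2) K by simp_all
    then show "K = add_nodes l M S \<or> lpart l K \<and> rank l K = rank l (add_nodes l M S) \<and>
        lex_less l K (add_nodes l M S)"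
      using lex[OF N T] K by blast
  next
    let ?L = "add_nodes l M S"
    have uM: "Poly_Mapping.lookup u M = 1" using u unfolding unitriangular_def by blast
    then have Mk: "M \<in> Poly_Mapping.keys u" by (simp add: in_keys_iff)
    have 0: "Poly_Mapping.lookup (?f N) ?L = 0" if N: "N \<in> Poly_Mapping.keys u" "N \<noteq> M" for N
      unfolding lookup_f_divpow_single[OF keys_lpart(1)[OF N(1)] e]
    proof (rule sum.neutral, rule ballI)
      fix T assume T: "T \<in> node_choices e l s j N (card S)"
      have "lex_less l (add_nodes l N T) ?L" using lex[OF N(1) T] N(2) by blast
      then have "add_nodes l N T \<noteq> ?L" using irrefl[of ?L] by auto
      then show "(if add_nodes l N T = ?L then qv powi choice_exp e l s j N T else 0) = 0" by simp
    qed
    have fin: "finite (node_choices e l s j M (card S))"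
      by (rule finite_subset[of _ "Pow (addables e l s j M)"]) (auto simp: finite_addables[OF M])
    have "Poly_Mapping.lookup (?f M) ?L = (\<Sum>T\<in>node_choices e l s j M (card S).
        if T = S then 1 else 0)"
      unfolding lookup_f_divpow_single[OF M e]
    proof (rule sum.cong[OF refl])
      fix T assume T: "T \<in> node_choices e l s j M (card S)"
      have "add_nodes l M T = ?L \<longleftrightarrow> T = S" using lex[OF Mk T] irrefl[of ?L] by auto
      then show "(if add_nodes l M T = ?L then qv powi choice_exp e l s j M T else 0)
          = (if T = S then 1 else 0)"
        using choice_exp_top[OF M e top] by simp
    qed
    also have "\<dots> = 1" using fin S by simp
    finally have 1: "Poly_Mapping.lookup (?f M) ?L = 1" .
    have "Poly_Mapping.lookup (f_divpow e l s j (card S) u) ?L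
        = (\<Sum>N\<in>Poly_Mapping.keys u. if N = M then 1 else 0)"
      unfolding lookup_f_divpow[of e l s j "card S" u]
      using 0 1 uM by (intro sum.cong) auto
    also have "\<dots> = 1" using Mk by simp
    finally show "Poly_Mapping.lookup (f_divpow e l s j (card S) u) ?L = 1" .
  qed
qed

lemma unitriangular_single: "unitriangular l (Poly_Mapping.single L 1) L"
  unfolding unitriangular_def by (auto simp: lookup_single when_def laurent_0 laurent_1)

section \<open>Matching staggered steps with blocks of equal residues\<close>

lemma finite_removed_nodes: "finite (removed_nodes l L \<gamma>)"
  by (rule finite_subset[OF _ finite_young[of l L]]) (auto simp: removed_nodes_def removable_def)

text \<open>Each step removes at least one node, so the head of \<open>rs\<close> is the residue of
  the next step and no empty block hides it.\<close>

lemma staggered_residues_hd: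
  assumes "staggered_residues e l s M rs" and e: "e > 1"
    and top: "top_addables e l s j M S" "S \<noteq> {}"
  shows "rs = [] \<or> hd rs \<noteq> j"
  using assms(1)
proof cases
  case (step j' \<gamma> M' rs')
  have "card (removed_nodes l M \<gamma>) \<noteq> 0"
    using staggered_step_top(3)[OF step(2) e step(3-5)] finite_removed_nodes[of l M \<gamma>] by simp
  then have "hd rs = j'" unfolding step(1) by (cases "card (removed_nodes l M \<gamma>)") auto
  then show ?thesis using staggered_residues_differ[OF e step(2) top] step(3) by blast
qed simp

text \<open>Uniqueness of the first run of a word. It identifies a block prescribed by the theorem
  with the nodes removed in one staggered step.\<close>

lemma replicate_append_eq:
  assumes eq: "replicate p x @ xs = replicate q y @ ys" and "p > 0" "q > 0"
    and hd: "xs = [] \<or> hd xs \<noteq> x" "ys = [] \<or> hd ys \<noteq> y"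
  shows "p = q \<and> x = y \<and> xs = ys"
proof -
  have "x = y" using arg_cong[OF eq, of hd] assms(2,3) by (cases p; cases q) auto
  \<comment> \<open>Cutting off the longest constant prefix recovers the first run from the
    word.\<close>
  have tw: "takeWhile (\<lambda>z. z = w) (replicate k w @ zs) = replicate k w"
    if "zs = [] \<or> hd zs \<noteq> w" for k w and zs :: "'a list"
    by (induction k) (use that in \<open>cases zs; simp\<close>)+
  have "replicate p x = replicate q y"
    using tw[OF hd(1), of p] tw[OF hd(2), of q] eq \<open>x = y\<close> by metis
  then have "p = q" by (metis length_replicate)
  then show ?thesis using eq \<open>x = y\<close> by simp
qed

definition blocks_word :: "(int \<times> nat) list \<Rightarrow> int list" where
  "blocks_word bs = concat (map (\<lambda>(j, r). replicate r j) bs)"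

text \<open>The first staggered step corresponds to the outermost operator, which restores the nodes
  removed by it. The rank is only bounded by \<open>n\<close>, since it drops along the induction
  while the charge gap stays fixed.\<close>

lemma staggered_unitriangular:
  fixes e :: int
  assumes "staggered_residues e l s L rs" and e: "e > 1"
    and gap: "\<forall>c\<in>{2..l}. s (c - 1) - s c \<ge> int n - 1 + e" and "rank l L \<le> n"
    and "rs = blocks_word bs" "\<forall>(j, r)\<in>set bs. r > 0" "successively (\<lambda>b b'. fst b \<noteq> fst b') bs"
  shows "unitriangular l (foldr (\<lambda>(j, r). f_divpow e l s j r) bs (Poly_Mapping.single empty_mpart 1)) L"
  using assms(1,4-7)
proof (induction arbitrary: bs rule: staggered_residues.induct)
  case empty
  have "bs = []"
  proof (cases bs)
    case (Cons b bs')
    then show ?thesis using empty(2,3) by (cases b) (simp add: blocks_word_def)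
  qed
  then show ?case by (simp add: unitriangular_single)
next
  case (step L j \<gamma> M rs)
  let ?S = "removed_nodes l L \<gamma>"
  note top = staggered_step_top[OF step(1) e step(2-4)]
  have r: "card ?S > 0" using top(3) finite_removed_nodes by (simp add: card_gt_0_iff)
  then have "bs \<noteq> []" using step.prems(2) by (auto simp: blocks_word_def)
  then obtain j' r' bs' where bs: "bs = (j', r') # bs'" by (metis list.exhaust surj_pair)
  have "blocks_word bs' = [] \<or> hd (blocks_word bs') \<noteq> j'"
  proof (cases bs')
    case (Cons b bs'')
    obtain k q where "b = (k, q)" by (cases b)
    moreover from this have "q > 0" "k \<noteq> j'" using step.prems(3,4) bs Cons by auto
    ultimately show ?thesis using Cons by (cases q) (auto simp: blocks_word_def)
  qed (simp add: blocks_word_def)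
  moreover have "replicate (card ?S) j @ rs = replicate r' j' @ blocks_word bs'"
    using step.prems(2) bs by (simp add: blocks_word_def)
  moreover have "r' > 0" using step.prems(3) bs by simp
  ultimately have *: "card ?S = r'" "j = j'" "rs = blocks_word bs'"
    using replicate_append_eq[of "card ?S" j rs r' j' "blocks_word bs'"] r
      staggered_residues_hd[OF step(5) e top(1,3)] by blast+
  have "?S \<subseteq> {\<gamma>. addable l M \<gamma>}" using top(1) addables_subset unfolding top_addables_def by blast
  then have "rank l M \<le> rank l L" using rank_add_nodes[OF step(3)] top(2) by (metis le_add1)
  then have rM: "rank l M \<le> n" using step.prems(1) by simp
  have "unitriangular l (foldr (\<lambda>(j, r). f_divpow e l s j r) bs' (Poly_Mapping.single empty_mpart 1)) M"
    using step.IH[OF rM *(3)] step.prems(3,4) bs by (cases bs') auto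
  from unitriangular_f_divpow[OF step(3) e gap rM top(1) this]
  show ?case unfolding bs using * top(2) by simp
qed

theorem mainTheorem3:
  fixes e :: int and l n m :: nat and s :: "nat \<Rightarrow> int" and L :: mpart
    and i :: "nat \<Rightarrow> int" and a :: "nat \<Rightarrow> nat"
  assumes "e > 1" and "l > 0" and "n > 0"
    and "\<forall>c\<in>{2..l}. s (c - 1) - s c \<ge> int n - 1 + e"
    and "lpart l L" and "rank l L = n" and "uglov e l s L"
    and "staggered_residues e l s L (concat (map (\<lambda>j. replicate (a j) (i j)) [1..<Suc m]))"
    and "\<forall>j\<in>{1..m}. i j \<in> {0..<e}" and "\<forall>j\<in>{1..m}. a j > 0"
    and "\<forall>j\<in>{1..<m}. i j \<noteq> i (Suc j)"
  shows "\<exists>c :: mpart \<Rightarrow> ratfun. (\<forall>M. laurent (c M)) \<and>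
    foldr (\<lambda>j. f_divpow e l s (i j) (a j)) [1..<Suc m] (Poly_Mapping.single empty_mpart 1) =
      Poly_Mapping.single L 1 +
      (\<Sum>M | lpart l M \<and> rank l M = n \<and> lex_less l M L. Poly_Mapping.single M (c M))"
proof -
  let ?bs = "map (\<lambda>j. (i j, a j)) [1..<Suc m]"
  let ?u = "foldr (\<lambda>j. f_divpow e l s (i j) (a j)) [1..<Suc m] (Poly_Mapping.single empty_mpart 1)"
  have word: "concat (map (\<lambda>j. replicate (a j) (i j)) [1..<Suc m]) = blocks_word ?bs"
    unfolding blocks_word_def by (simp only: map_map comp_def prod.case)
  have positive: "\<forall>(j, r)\<in>set ?bs. r > 0" using assms(10) by auto
  have distinct: "successively (\<lambda>b b'. fst b \<noteq> fst b') ?bs"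
    unfolding successively_conv_nth using assms(11) by (auto simp del: upt_Suc)
  have fold: "foldr (\<lambda>(j, r). f_divpow e l s j r) ?bs (Poly_Mapping.single empty_mpart 1) = ?u"
    by (simp only: foldr_map comp_def prod.case)
  have u: "unitriangular l ?u L"
    using staggered_unitriangular[OF assms(8,1,4) eq_refl[OF assms(6)] word positive distinct]
    unfolding fold .
  \<comment> \<open>The coordinates of the vector itself serve as coefficients;
    \<open>unitriangular\<close> makes all of them Laurent, including those outside the sum.\<close>
  show ?thesis
    using unitriangular_expand[OF u] u unfolding unitriangular_def assms(6)
    by (intro exI[of _ "Poly_Mapping.lookup ?u"] conjI) simp_all
qed

end
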